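(* Let $G,H\in\mathcal{RH}_\infty^{m\times m}$ with $H$ invertible. The closed-loop system $G(s)\#H(s)$ is stable if, for each $\omega\in[0,\infty)$, at least one of the following conditions holds: 1) (small gain) $\overline\sigma(G(j\omega))\,\overline\sigma(H(j\omega))<1$; 2) (small phase) $G(j\omega)$ and $H(j\omega)$ are sectorial, $\overline\phi(G(j\omega))+\overline\phi(H(j\omega))<\pi$ and $\underline\phi(G(j\omega))+\underline\phi(H(j\omega))>-\pi$; 3) (numerical range separation) $W(G(j\omega))\cap W\!\left(-\tfrac1\tau H^{-1}(j\omega)\right)=\varnothing$ for all $\tau\in(0,1]$; 4) ($x$-$z$ graph separation) $P(G(j\omega))\cap P\!\left(-\tfrac1\tau H^{-1}(j\omega)\right)=\varnothing$ for all $\tau\in(0,1]$; 5) (DW shell separation) $DW(G(j\omega))\cap DW\!\left(-\tfrac1\tau H^{-1}(j\omega)\right)=\varnothing$ for all $\tau\in(0,1]$; 6) (sufficient version of the generalized Nyquist criterion) $\det\left(I+\tau G(j\omega)H(j\omega)\right)\neq 0$ for all $\tau\in(0,1]$.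
   Context: $\mathcal{RH}_\infty^{m\times m}$ is the set of real, rational, proper, stable $m\times m$ transfer function matrices. $H^{-1}(j\omega)$ denotes the inverse of $H$ evaluated at $j\omega$. For $G,H\in\mathcal{RH}_\infty^{m\times m}$, the standard (negative) feedback interconnection is described by $$G\#H=\begin{bmatrix}(I+HG)^{-1} & (I+HG)^{-1}H\\ G(I+HG)^{-1} & G(I+HG)^{-1}H\end{bmatrix},$$ and the closed-loop system is called stable if $G\#H\in\mathcal{RH}_\infty^{2m\times 2m}$. For a complex matrix $A\in\mathbb{C}^{n\times n}$: $\overline\sigma(A)$ is the largest singular value. The numerical range is $W(A)=\{x^*Ax: x\in\mathbb{C}^n,\|x\|=1\}$ (Euclidean norm). $A$ is sectorial if $0\notin W(A)$. A sectorial $A$ has a decomposition $A=T^*DT$ with $T$ nonsingular and $D$ diagonal unitary, $D$ unique up to permutation and with all diagonal entries on an arc of the unit circle of length smaller than $\pi$. The phases $\overline\phi(A)=\phi_1(A)\ge\dots\ge\phi_n(A)=\underline\phi(A)$ are the arguments of the diagonal entries of $D$, chosen so that $\overline\phi(A)-\underline\phi(A)<\pi$, with the usual convention (fixing the common multiple of $2\pi$) that $\tfrac12(\overline\phi(A)+\underline\phi(A))\in(-\pi,\pi]$. The Davis-Wielandt (DW) shell is $DW(A)=\{(x^*Ax,\|Ax\|^2): x\in\mathbb{C}^n,\|x\|=1\}\subset\mathbb{C}\times\mathbb{R}$. The $x$-$z$ graph is its projection onto the $x$-$z$ plane ($\mathbb{C}$ being identified with the $x$-$y$ plane), $P(A)=\{(\Re(x^*Ax),\|Ax\|^2):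 x\in\mathbb{C}^n,\|x\|=1\}\subset\mathbb{R}^2$.
   Formalization: The frequency range is [0,∞] instead of [0,∞): at ω=∞ (the limit of G(jω), H(jω)) one of the six conditions must also hold. Over finite ω only, the claim fails: G=-s/(s+1), H=1 satisfies 1) at each finite ω, but (I+HG)^{-1}=s+1 is improper. *)

theory Defs
  imports
    "HOL-Analysis.Analysis"
    "HOL-Computational_Algebra.Computational_Algebra"
    "HOL-Computational_Algebra.Field_as_Ring"
begin

section \<open>Transfer function matrices\<close>

text \<open>
  A real rational function is an element of the fraction field of the real polynomials;
  \<open>quot_of_fract\<close> yields its coprime numerator and denominator, so that the roots of the
  denominator are exactly the poles.
\<close>

type_synonym 'n tf_matrix = "real poly fract ^ 'n ^ 'n"

definition tf_num :: "real poly fract \<Rightarrow> real poly" where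
  "tf_num f = fst (quot_of_fract f)"

definition tf_den :: "real poly fract \<Rightarrow> real poly" where
  "tf_den f = snd (quot_of_fract f)"

definition cpoly :: "real poly \<Rightarrow> complex \<Rightarrow> complex" where
  "cpoly p s = poly (map_poly complex_of_real p) s"

definition proper_tf :: "real poly fract \<Rightarrow> bool" where
  "proper_tf f \<longleftrightarrow> degree (tf_num f) \<le> degree (tf_den f)"

definition stable_tf :: "real poly fract \<Rightarrow> bool" where
  "stable_tf f \<longleftrightarrow> (\<forall>s. Re s \<ge> 0 \<longrightarrow> cpoly (tf_den f) s \<noteq> 0)"

definition RH_inf :: "('n::finite) tf_matrix set" where
  "RH_inf = {G. \<forall>i k. proper_tf (G $ i $ k) \<and> stable_tf (G $ i $ k)}"

definition tf_eval :: "real poly fract \<Rightarrow> complex \<Rightarrow> complex" where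
  "tf_eval f s = cpoly (tf_num f) s / cpoly (tf_den f) s"

text \<open>
  The frequency response \<open>G(j\<omega>)\<close>. The frequency ranges over the closed half-line: the value
  \<open>G(j\<infinity>)\<close> is the limit for \<open>\<omega> \<rightarrow> \<infinity>\<close>, which exists for proper \<open>G\<close>.
  Conditions at finite frequencies alone do not control the closed loop when \<open>GH\<close> is not strictly
  proper: for \<open>G = -s/(s + 1)\<close> and \<open>H = 1\<close> the loop gain is below one at every finite frequency,
  but \<open>(1 + HG)\<^sup>-\<^sup>1 = s + 1\<close> is improper.
\<close>

definition freq_resp :: "('n::finite) tf_matrix \<Rightarrow> ereal \<Rightarrow> complex ^ 'n ^ 'n" where
  "freq_resp G \<omega> = (\<chi> i k.
     if \<omega> = \<infinity> then Lim at_top (\<lambda>t::real. tf_eval (G $ i $ k) (\<i> * complex_of_real t))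
     else tf_eval (G $ i $ k) (\<i> * complex_of_real (real_of_ereal \<omega>)))"

definition block_matrix ::
  "'a ^ 'n ^ 'n \<Rightarrow> 'a ^ 'n ^ 'n \<Rightarrow> 'a ^ 'n ^ 'n \<Rightarrow> 'a ^ 'n ^ 'n \<Rightarrow> 'a ^ ('n + 'n) ^ ('n::finite + 'n)" where
  "block_matrix A B C D = (\<chi> i k.
     case i of
       Inl a \<Rightarrow> (case k of Inl b \<Rightarrow> A $ a $ b | Inr b \<Rightarrow> B $ a $ b)
     | Inr a \<Rightarrow> (case k of Inl b \<Rightarrow> C $ a $ b | Inr b \<Rightarrow> D $ a $ b))"

definition feedback :: "('n::finite) tf_matrix \<Rightarrow> 'n tf_matrix \<Rightarrow> ('n + 'n) tf_matrix" where
  "feedback G H = (let S = matrix_inv (mat 1 + H ** G) in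
     block_matrix S (S ** H) (G ** S) (G ** S ** H))"

text \<open>
  Since \<open>matrix_inv\<close> is total, the existence of \<open>(I + HG)\<^sup>-\<^sup>1\<close> over the rational functions, which
  is implicit in the formula for the feedback interconnection, is stated separately.
\<close>

definition closed_loop_stable :: "('n::finite) tf_matrix \<Rightarrow> 'n tf_matrix \<Rightarrow> bool" where
  "closed_loop_stable G H \<longleftrightarrow> invertible (mat 1 + H ** G) \<and> feedback G H \<in> RH_inf"


section \<open>Complex matrices\<close>

definition ctranspose :: "complex ^ 'n ^ 'm \<Rightarrow> complex ^ 'm ^ 'n" where
  "ctranspose A = (\<chi> i k. cnj (A $ k $ i))"

definition singular_values :: "complex ^ 'n ^ 'n \<Rightarrow> real set" where
  "singular_values A = {\<sigma>. \<sigma> \<ge> 0 \<and>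
     (\<exists>v. v \<noteq> 0 \<and> (ctranspose A ** A) *v v = complex_of_real (\<sigma>\<^sup>2) *s v)}"

definition max_sv :: "complex ^ 'n ^ 'n \<Rightarrow> real" where
  "max_sv A = Max (singular_values A)"

text \<open>The quadratic form \<open>x\<^sup>*Ax\<close>.\<close>

definition qform :: "complex ^ 'n ^ 'n \<Rightarrow> complex ^ 'n \<Rightarrow> complex" where
  "qform A x = (\<Sum>i\<in>UNIV. cnj (x $ i) * (A *v x) $ i)"

definition num_range :: "complex ^ 'n ^ 'n \<Rightarrow> complex set" where
  "num_range A = {qform A x | x. norm x = 1}"

definition DW_shell :: "complex ^ 'n ^ 'n \<Rightarrow> (complex \<times> real) set" where
  "DW_shell A = {(qform A x, (norm (A *v x))\<^sup>2) | x. norm x = 1}"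

definition xz_graph :: "complex ^ 'n ^ 'n \<Rightarrow> (real \<times> real) set" where
  "xz_graph A = {(Re (qform A x), (norm (A *v x))\<^sup>2) | x. norm x = 1}"

definition sectorial :: "complex ^ 'n ^ 'n \<Rightarrow> bool" where
  "sectorial A \<longleftrightarrow> 0 \<notin> num_range A"

definition diag_unitary :: "('n \<Rightarrow> real) \<Rightarrow> complex ^ 'n ^ 'n" where
  "diag_unitary \<theta> = (\<chi> i k. if i = k then cis (\<theta> i) else 0)"

text \<open>
  \<open>\<theta>\<close> lists arguments of the diagonal entries of \<open>D\<close> in a decomposition \<open>A = T\<^sup>*DT\<close>, with the
  common multiple of \<open>2\<pi>\<close> fixed by the position of the midpoint of the largest and smallest one.
  For sectorial \<open>A\<close> such a \<open>\<theta>\<close> exists and is unique up to a permutation of the index type, so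
  that the largest and the smallest phase do not depend on the choice made in \<open>phases\<close>.
\<close>

definition is_phases :: "complex ^ 'n ^ 'n \<Rightarrow> ('n::finite \<Rightarrow> real) \<Rightarrow> bool" where
  "is_phases A \<theta> \<longleftrightarrow>
     (\<exists>T. invertible T \<and> A = ctranspose T ** diag_unitary \<theta> ** T) \<and>
     Max (range \<theta>) - Min (range \<theta>) < pi \<and>
     (Max (range \<theta>) + Min (range \<theta>)) / 2 \<in> {- pi<..pi}"

definition phases :: "complex ^ 'n ^ 'n \<Rightarrow> ('n::finite \<Rightarrow> real)" where
  "phases A = (SOME \<theta>. is_phases A \<theta>)"

definition max_phase :: "complex ^ 'n ^ 'n::finite \<Rightarrow> real" where
  "max_phase A = Max (range (phases A))"

definition min_phase :: "complex ^ 'n ^ 'n::finite \<Rightarrow> real" where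
  "min_phase A = Min (range (phases A))"

end

theory Submission
  imports Defs "HOL-Complex_Analysis.Complex_Analysis"
begin

text \<open>
  Each of the six conditions at a frequency \<open>\<omega>\<close> forces \<open>det (I + \<tau> H G) \<noteq> 0\<close> at \<open>\<omega>\<close> for all
  \<open>\<tau> \<in> [0, 1]\<close>: a null vector \<open>y\<close>, i.e. \<open>\<tau> H G y = - y\<close>, gives \<open>G y = - \<tau>\<^sup>-\<^sup>1 H\<^sup>-\<^sup>1 y\<close>, so that the shells
  meet; it contradicts the norm bound in the small gain case; and in the small phase case the
  quadratic forms of \<open>G\<close> at \<open>y\<close> and of \<open>H\<close> at \<open>G y\<close> would have phases adding up to \<open>\<plusminus>\<pi>\<close>.

  The Cayley transform turns the closed right half-plane with \<open>\<infinity>\<close> into the closed unit disc.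
  There \<open>det (I + \<tau> H G)\<close> is a homotopy of functions, continuous on the disc and holomorphic inside,
  that starts at the constant \<open>1\<close> and is bounded away from \<open>0\<close> on the circle, say by \<open>d\<close>. The maximum
  principle for the reciprocal replaces the argument principle: a zero-free member of the homotopy is
  bounded below by \<open>d\<close> on the whole disc, hence nearby members are zero-free as well. So
  \<open>det (I + H G)\<close> is a unit in the ring of proper stable functions, and Cramer's rule yields the
  stability of \<open>(I + H G)\<^sup>-\<^sup>1\<close>.
\<close>

no_notation fps_nth (infixl \<open>$\<close> 75)

section \<open>The ring of proper stable rational functions\<close>

lemma cpoly_0 [simp]: "cpoly 0 s = 0"
  and cpoly_pCons [simp]: "cpoly (pCons a p) s = of_real a + s * cpoly p s"
  by (simp_all add: cpoly_def map_poly_pCons)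

lemma cpoly_1 [simp]: "cpoly 1 s = 1"
  by (simp add: cpoly_def)

lemma cpoly_add [simp]: "cpoly (p + q) s = cpoly p s + cpoly q s"
  by (induction p q rule: poly_induct2) (simp_all add: algebra_simps)

lemma cpoly_minus [simp]: "cpoly (- p) s = - cpoly p s"
  by (induction p) simp_all

lemma cpoly_smult [simp]: "cpoly (smult c p) s = of_real c * cpoly p s"
  by (induction p) (simp_all add: algebra_simps)

lemma cpoly_mult [simp]: "cpoly (p * q) s = cpoly p s * cpoly q s"
  by (induction p) (simp_all add: algebra_simps)

lemma cpoly_cnj: "cpoly p (cnj s) = cnj (cpoly p s)"
  by (induction p) simp_all

lemma holomorphic_cpoly [holomorphic_intros]: "cpoly p holomorphic_on A"
  by (simp add: cpoly_def [abs_def] holomorphic_intros)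

lemma cpoly_tendsto: "((\<lambda>s. cpoly p s / s ^ degree p) \<longlongrightarrow> of_real (lead_coeff p)) at_infinity"
proof -
  have "degree (map_poly complex_of_real p) = degree p"
    by (rule degree_map_poly) simp
  with poly_divide_tendsto_aux [of "map_poly complex_of_real p"] show ?thesis
    by (simp add: cpoly_def coeff_map_poly)
qed

lemma tf_eval_cnj: "tf_eval f (cnj s) = cnj (tf_eval f s)"
  by (simp add: tf_eval_def cpoly_cnj)

lemma tf_den_nonzero [simp]: "tf_den f \<noteq> 0"
  by (simp add: tf_den_def)

lemma Fract_tf: "Fract (tf_num f) (tf_den f) = f"
  by (simp add: tf_num_def tf_den_def)

text \<open>Cross-multiplying shows that \<open>tf_den f\<close> divides
  \<open>tf_num f * q\<close>, and coprimality then forces it to divide \<open>q\<close>. Hence any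
  representing fraction differs from the reduced one by a common factor \<open>r\<close>.\<close>

lemma Fract_eq_tf:
  assumes "f = Fract p q" "q \<noteq> 0"
  obtains r where "p = tf_num f * r" "q = tf_den f * r"
proof -
  have "Fract (tf_num f) (tf_den f) = Fract p q"
    using assms by (simp add: Fract_tf)
  then have eq: "tf_num f * q = p * tf_den f"
    using assms(2) by (simp add: eq_fract)
  then have "tf_den f dvd tf_num f * q"
    by simp
  moreover have "coprime (tf_den f) (tf_num f)"
    by (simp add: tf_den_def tf_num_def coprime_quot_of_fract coprime_commute)
  ultimately obtain r where r: "q = tf_den f * r"
    by (auto simp: coprime_dvd_mult_right_iff)
  with eq have "tf_den f * p = tf_den f * (tf_num f * r)"
    by (simp add: algebra_simps)
  then have "p = tf_num f * r"
    by simp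
  with r that show thesis by blast
qed

lemma tf_eval_Fract:
  assumes "cpoly q s \<noteq> 0"
  shows "tf_eval (Fract p q) s = cpoly p s / cpoly q s"
proof -
  have "q \<noteq> 0" using assms by auto
  then obtain r where r: "p = tf_num (Fract p q) * r" "q = tf_den (Fract p q) * r"
    using Fract_eq_tf by blast
  then have "cpoly p s = cpoly (tf_num (Fract p q)) s * cpoly r s"
    "cpoly q s = cpoly (tf_den (Fract p q)) s * cpoly r s"
    by (metis cpoly_mult)+
  with assms show ?thesis
    by (simp add: tf_eval_def)
qed

definition RH_scalars :: "real poly fract set" where
  "RH_scalars = {f. proper_tf f \<and> stable_tf f}"

lemma RH_inf_iff: "G \<in> RH_inf \<longleftrightarrow> (\<forall>i k. G $ i $ k \<in> RH_scalars)"
  by (simp add: RH_inf_def RH_scalars_def)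

text \<open>Cancelling a common factor lowers both degrees equally and only removes zeros of the
  denominator, so an unreduced fraction suffices to certify membership.\<close>

lemma RH_scalarsI:
  assumes "f = Fract p q" "degree p \<le> degree q" "\<And>s. Re s \<ge> 0 \<Longrightarrow> cpoly q s \<noteq> 0"
  shows "f \<in> RH_scalars"
proof -
  have q: "q \<noteq> 0" using assms(3) [of 0] by auto
  then obtain r where r: "p = tf_num f * r" "q = tf_den f * r"
    using Fract_eq_tf assms(1) by blast
  have "stable_tf f"
    unfolding stable_tf_def using assms(3) r(2) by (metis cpoly_mult mult_zero_left)
  moreover have "proper_tf f"
  \<comment> \<open>Degrees add only for nonzero factors; for numerator 0 the claim is trivial
    because \<open>degree 0 = 0\<close>.\<close>
  proof (cases "tf_num f = 0")
    case False
    then have "degree (tf_num f) + degree r \<le> degree (tf_den f) + degree r"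
      using assms(2) q r by (metis degree_mult_eq mult_not_zero)
    then show ?thesis by (simp add: proper_tf_def)
  qed (simp add: proper_tf_def)
  ultimately show ?thesis by (simp add: RH_scalars_def)
qed

lemma RH_scalarsE:
  assumes "f \<in> RH_scalars"
  obtains p q where "f = Fract p q" "q \<noteq> 0" "degree p \<le> degree q"
    "\<And>s. Re s \<ge> 0 \<Longrightarrow> cpoly q s \<noteq> 0" "\<And>s. Re s \<ge> 0 \<Longrightarrow> tf_eval f s = cpoly p s / cpoly q s"
  using assms that [of "tf_num f" "tf_den f"]
  by (simp add: RH_scalars_def proper_tf_def stable_tf_def Fract_tf tf_eval_def)

lemma RH_scalars_const: "Fract [:c:] 1 \<in> RH_scalars"
  by (rule RH_scalarsI [of _ "[:c:]" 1]) simp_all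

lemma RH_scalars_0 [simp]: "0 \<in> RH_scalars" and RH_scalars_1 [simp]: "1 \<in> RH_scalars"
  using RH_scalars_const [of 0] RH_scalars_const [of 1]
  by (simp_all add: Zero_fract_def One_fract_def one_pCons)

lemma tf_eval_0 [simp]: "tf_eval 0 s = 0" and tf_eval_1 [simp]: "tf_eval 1 s = 1"
  by (simp_all add: tf_eval_def tf_num_def tf_den_def)

text \<open>The common denominator \<open>q * q'\<close> has no zero in the closed right half-plane.
  Evaluation is compared only there: at a pole \<open>tf_eval\<close> is 0 by division by zero, and
  additivity can fail.\<close>

lemma RH_scalars_add_aux:
  assumes "f \<in> RH_scalars" "g \<in> RH_scalars"
  shows "f + g \<in> RH_scalars \<and> (\<forall>s. Re s \<ge> 0 \<longrightarrow> tf_eval (f + g) s = tf_eval f s + tf_eval g s)"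
proof -
  obtain p q where f: "f = Fract p q" "q \<noteq> 0" "degree p \<le> degree q"
    "\<And>s. Re s \<ge> 0 \<Longrightarrow> cpoly q s \<noteq> 0" "\<And>s. Re s \<ge> 0 \<Longrightarrow> tf_eval f s = cpoly p s / cpoly q s"
    using RH_scalarsE [OF assms(1)] by metis
  obtain p' q' where g: "g = Fract p' q'" "q' \<noteq> 0" "degree p' \<le> degree q'"
    "\<And>s. Re s \<ge> 0 \<Longrightarrow> cpoly q' s \<noteq> 0" "\<And>s. Re s \<ge> 0 \<Longrightarrow> tf_eval g s = cpoly p' s / cpoly q' s"
    using RH_scalarsE [OF assms(2)] by metis
  have fg: "f + g = Fract (p * q' + p' * q) (q * q')"
    using f g by (simp add: add_fract)
  have "degree (p * q') \<le> degree (q * q')" "degree (p' * q) \<le> degree (q * q')"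
    using degree_mult_le [of p q'] degree_mult_le [of p' q] f(2,3) g(2,3)
    by (simp_all add: degree_mult_eq)
  then have "degree (p * q' + p' * q) \<le> degree (q * q')"
    by (rule degree_add_le)
  then have "f + g \<in> RH_scalars"
    using f g by (intro RH_scalarsI [OF fg]) auto
  moreover have "tf_eval (f + g) s = tf_eval f s + tf_eval g s" if "Re s \<ge> 0" for s
    using that f(4,5) g(4,5) unfolding fg by (subst tf_eval_Fract) (auto simp: field_simps)
  ultimately show ?thesis by blast
qed

lemma RH_scalars_mult_aux:
  assumes "f \<in> RH_scalars" "g \<in> RH_scalars"
  shows "f * g \<in> RH_scalars \<and> (\<forall>s. Re s \<ge> 0 \<longrightarrow> tf_eval (f * g) s = tf_eval f s * tf_eval g s)"
proof -
  obtain p q where f: "f = Fract p q" "q \<noteq> 0" "degree p \<le> degree q"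
    "\<And>s. Re s \<ge> 0 \<Longrightarrow> cpoly q s \<noteq> 0" "\<And>s. Re s \<ge> 0 \<Longrightarrow> tf_eval f s = cpoly p s / cpoly q s"
    using RH_scalarsE [OF assms(1)] by metis
  obtain p' q' where g: "g = Fract p' q'" "q' \<noteq> 0" "degree p' \<le> degree q'"
    "\<And>s. Re s \<ge> 0 \<Longrightarrow> cpoly q' s \<noteq> 0" "\<And>s. Re s \<ge> 0 \<Longrightarrow> tf_eval g s = cpoly p' s / cpoly q' s"
    using RH_scalarsE [OF assms(2)] by metis
  have fg: "f * g = Fract (p * p') (q * q')"
    using f g by simp
  have "degree (p * p') \<le> degree (q * q')"
    using degree_mult_le [of p p'] f(2,3) g(2,3) by (simp add: degree_mult_eq)
  then have "f * g \<in> RH_scalars"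
    using f g by (intro RH_scalarsI [OF fg]) auto
  moreover have "tf_eval (f * g) s = tf_eval f s * tf_eval g s" if "Re s \<ge> 0" for s
    using that f(4,5) g(4,5) unfolding fg by (subst tf_eval_Fract) simp_all
  ultimately show ?thesis by blast
qed

lemma RH_scalars_add: "f \<in> RH_scalars \<Longrightarrow> g \<in> RH_scalars \<Longrightarrow> f + g \<in> RH_scalars"
  and RH_scalars_mult: "f \<in> RH_scalars \<Longrightarrow> g \<in> RH_scalars \<Longrightarrow> f * g \<in> RH_scalars"
  and tf_eval_add: "f \<in> RH_scalars \<Longrightarrow> g \<in> RH_scalars \<Longrightarrow> Re s \<ge> 0 \<Longrightarrow>
    tf_eval (f + g) s = tf_eval f s + tf_eval g s"
  and tf_eval_mult: "f \<in> RH_scalars \<Longrightarrow> g \<in> RH_scalars \<Longrightarrow> Re s \<ge> 0 \<Longrightarrow>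
    tf_eval (f * g) s = tf_eval f s * tf_eval g s"
  using RH_scalars_add_aux [of f g] RH_scalars_mult_aux [of f g] by blast+

lemma RH_scalars_sum: "(\<And>i. i \<in> I \<Longrightarrow> f i \<in> RH_scalars) \<Longrightarrow> sum f I \<in> RH_scalars"
  by (induction I rule: infinite_finite_induct) (auto intro: RH_scalars_add)

lemma RH_scalars_prod: "(\<And>i. i \<in> I \<Longrightarrow> f i \<in> RH_scalars) \<Longrightarrow> prod f I \<in> RH_scalars"
  by (induction I rule: infinite_finite_induct) (auto intro: RH_scalars_mult)

lemma tf_eval_sum:
  "(\<And>i. i \<in> I \<Longrightarrow> f i \<in> RH_scalars) \<Longrightarrow> Re s \<ge> 0 \<Longrightarrow> tf_eval (sum f I) s = (\<Sum>i\<in>I. tf_eval (f i) s)"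
  by (induction I rule: infinite_finite_induct) (simp_all add: tf_eval_add RH_scalars_sum)

lemma tf_eval_prod:
  "(\<And>i. i \<in> I \<Longrightarrow> f i \<in> RH_scalars) \<Longrightarrow> Re s \<ge> 0 \<Longrightarrow> tf_eval (prod f I) s = (\<Prod>i\<in>I. tf_eval (f i) s)"
  by (induction I rule: infinite_finite_induct) (simp_all add: tf_eval_mult RH_scalars_prod)

lemma RH_scalars_sign: "of_int (sign p) \<in> RH_scalars"
  and tf_eval_sign: "tf_eval (of_int (sign p)) s = of_int (sign p)"
proof -
  have m1: "(-1 :: real poly fract) = Fract [:-1:] 1"
    by (simp add: One_fract_def one_pCons)
  show "of_int (sign p) \<in> RH_scalars"
    using RH_scalars_const [of "-1"] by (simp add: sign_def m1)
  have "tf_eval (- 1) s = - 1"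
    unfolding m1 by (subst tf_eval_Fract) simp_all
  then show "tf_eval (of_int (sign p)) s = of_int (sign p)"
    by (simp add: sign_def)
qed

section \<open>Transfer matrices over the ring: evaluation, determinants and inverses\<close>

definition mat_eval :: "('n::finite) tf_matrix \<Rightarrow> complex \<Rightarrow> complex ^ 'n ^ 'n" where
  "mat_eval G s = (\<chi> i k. tf_eval (G $ i $ k) s)"

lemma RH_scalars_det:
  assumes "\<And>i k. (A :: ('n::finite) tf_matrix) $ i $ k \<in> RH_scalars"
  shows "det A \<in> RH_scalars"
  unfolding det_def
  by (intro RH_scalars_sum RH_scalars_mult RH_scalars_sign RH_scalars_prod assms)

lemma tf_eval_det:
  assumes "\<And>i k. (A :: ('n::finite) tf_matrix) $ i $ k \<in> RH_scalars" "Re s \<ge> 0"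
  shows "tf_eval (det A) s = det (mat_eval A s)"
  unfolding det_def mat_eval_def using assms
  by (simp add: tf_eval_sum tf_eval_mult tf_eval_prod tf_eval_sign RH_scalars_sign
      RH_scalars_mult RH_scalars_prod)

lemma RH_inf_mult: "A \<in> RH_inf \<Longrightarrow> B \<in> RH_inf \<Longrightarrow> A ** B \<in> RH_inf"
  by (auto simp: RH_inf_iff matrix_matrix_mult_def intro!: RH_scalars_sum RH_scalars_mult)

lemma RH_inf_add: "A \<in> RH_inf \<Longrightarrow> B \<in> RH_inf \<Longrightarrow> A + B \<in> RH_inf"
  by (auto simp: RH_inf_iff intro!: RH_scalars_add)

lemma RH_inf_mat_1: "mat 1 \<in> RH_inf"
  by (simp add: RH_inf_iff mat_def)

lemma mat_eval_mult:
  "A \<in> RH_inf \<Longrightarrow> B \<in> RH_inf \<Longrightarrow> Re s \<ge> 0 \<Longrightarrow> mat_eval (A ** B) s = mat_eval A s ** mat_eval B s"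
  by (simp add: RH_inf_iff mat_eval_def matrix_matrix_mult_def vec_eq_iff tf_eval_sum tf_eval_mult
      RH_scalars_mult)

lemma mat_eval_add:
  "A \<in> RH_inf \<Longrightarrow> B \<in> RH_inf \<Longrightarrow> Re s \<ge> 0 \<Longrightarrow> mat_eval (A + B) s = mat_eval A s + mat_eval B s"
  by (simp add: RH_inf_iff mat_eval_def vec_eq_iff tf_eval_add)

lemma mat_eval_mat_1: "mat_eval (mat 1) s = mat 1"
  by (simp add: mat_eval_def mat_def vec_eq_iff)

text \<open>The limit at infinity of a proper function: the ratio of leading coefficients if the
  degrees agree, and 0 if the numerator has smaller degree, because its coefficient at
  \<open>degree (tf_den f)\<close> is then 0.\<close>

definition tf_inf :: "real poly fract \<Rightarrow> complex" where
  "tf_inf f = of_real (coeff (tf_num f) (degree (tf_den f)) / lead_coeff (tf_den f))"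

lemma tf_eval_tendsto_inf:
  assumes "proper_tf f"
  shows "(tf_eval f \<longlongrightarrow> tf_inf f) at_infinity"
proof (cases "degree (tf_num f) = degree (tf_den f)")
  case True
  have "((\<lambda>s. (cpoly (tf_num f) s / s ^ degree (tf_num f)) / (cpoly (tf_den f) s / s ^ degree (tf_den f)))
     \<longlongrightarrow> of_real (lead_coeff (tf_num f)) / of_real (lead_coeff (tf_den f))) at_infinity"
    by (intro tendsto_divide cpoly_tendsto) simp
  moreover have "\<forall>\<^sub>F s in at_infinity. (cpoly (tf_num f) s / s ^ degree (tf_num f)) /
      (cpoly (tf_den f) s / s ^ degree (tf_den f)) = tf_eval f s"
    by (rule eventually_at_infinityI [of 1]) (auto simp: True tf_eval_def)
  ultimately show ?thesis
    unfolding tf_inf_def using True by (auto intro: Lim_transform_eventually)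
next
  case False
  then have *: "degree (tf_num f) < degree (tf_den f)"
    using assms by (simp add: proper_tf_def)
  have "degree (map_poly complex_of_real p) = degree p" for p
    by (rule degree_map_poly) simp
  with * poly_divide_tendsto_0_at_infinity [of "map_poly complex_of_real (tf_num f)" "map_poly complex_of_real (tf_den f)"]
  show ?thesis
    by (simp add: tf_inf_def tf_eval_def [abs_def] cpoly_def coeff_eq_0)
qed

text \<open>A criterion for units of the ring: the nonzero value at infinity makes the reciprocal
  proper, the absence of zeros in the closed right half-plane makes it stable.\<close>

lemma RH_scalars_inverse:
  assumes "f \<in> RH_scalars" "tf_inf f \<noteq> 0" "\<And>s. Re s \<ge> 0 \<Longrightarrow> tf_eval f s \<noteq> 0"
  shows "inverse f \<in> RH_scalars"
proof (rule RH_scalarsI)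
  have "tf_num f \<noteq> 0" using assms(2) by (auto simp: tf_inf_def)
  have "inverse f = inverse (Fract (tf_num f) (tf_den f))" by (simp add: Fract_tf)
  then show "inverse f = Fract (tf_den f) (tf_num f)" by simp
  have "coeff (tf_num f) (degree (tf_den f)) \<noteq> 0" using assms(2) by (auto simp: tf_inf_def)
  then show "degree (tf_den f) \<le> degree (tf_num f)" by (rule le_degree)
  show "cpoly (tf_num f) s \<noteq> 0" if "Re s \<ge> 0" for s
    using assms(3) [OF that] by (auto simp: tf_eval_def)
qed

text \<open>Column \<open>k\<close> of the inverse solves \<open>A *v x = axis k 1\<close>; by
  Cramer's rule its entries are determinants over the ring times
  \<open>inverse (det A)\<close>.\<close>

lemma RH_inf_matrix_inv:
  assumes "A \<in> RH_inf" "det A \<noteq> 0" "inverse (det A) \<in> RH_scalars"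
  shows "matrix_inv A \<in> RH_inf"
  unfolding RH_inf_iff
proof (intro allI)
  fix i k
  have "invertible A" using assms(2) by (simp add: invertible_det_nz)
  then have "A ** matrix_inv A = mat 1"
    unfolding invertible_def matrix_inv_def by (metis (mono_tags, lifting) someI_ex)
  then have "A *v (matrix_inv A *v axis k 1) = axis k 1"
    by (simp add: matrix_vector_mul_assoc)
  then have "(matrix_inv A *v axis k 1) $ i =
      det (\<chi> i' j. if j = i then axis k 1 $ i' else A $ i' $ j) / det A"
    using cramer [OF assms(2)] by simp
  moreover have "(matrix_inv A *v axis k 1) $ i = matrix_inv A $ i $ k"
    by (simp add: matrix_vector_mult_def axis_def if_distrib cong: if_cong)
  moreover have "det (\<chi> i' j. if j = i then axis k 1 $ i' else A $ i' $ j) \<in> RH_scalars"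
    using assms(1) by (intro RH_scalars_det) (auto simp: RH_inf_iff axis_def)
  ultimately show "matrix_inv A $ i $ k \<in> RH_scalars"
    using assms(3) by (auto simp: divide_inverse intro: RH_scalars_mult)
qed

text \<open>All blocks of the closed loop are products of \<open>G\<close>, \<open>H\<close> and the
  inverse of \<open>mat 1 + H ** G\<close>, so it is enough that the determinant of the latter is a
  unit of the ring.\<close>

lemma closed_loop_stableI:
  assumes "G \<in> RH_inf" "H \<in> RH_inf"
    and "tf_inf (det (mat 1 + H ** G)) \<noteq> 0"
    and nz: "\<And>s. Re s \<ge> 0 \<Longrightarrow> det (mat 1 + mat_eval H s ** mat_eval G s) \<noteq> 0"
  shows "closed_loop_stable G H"
proof -
  let ?A = "mat 1 + H ** G"
  have A: "?A \<in> RH_inf"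
    by (intro RH_inf_add RH_inf_mult RH_inf_mat_1 assms)
  have "tf_eval (det ?A) s \<noteq> 0" if "Re s \<ge> 0" for s
    using A that nz [OF that] assms(1,2)
    by (simp add: RH_inf_iff [of ?A] tf_eval_det mat_eval_add mat_eval_mult mat_eval_mat_1
        RH_inf_mult RH_inf_mat_1)
  \<comment> \<open>The nonzero value at infinity also excludes \<open>det ?A = 0\<close>, since
    \<open>tf_inf 0 = 0\<close>.\<close>
  then have "inverse (det ?A) \<in> RH_scalars" and nz': "det ?A \<noteq> 0"
    using A assms(3) by (auto intro!: RH_scalars_inverse RH_scalars_det simp: RH_inf_iff tf_inf_def tf_num_def)
  then have S: "matrix_inv ?A \<in> RH_inf"
    using A by (intro RH_inf_matrix_inv)
  have "matrix_inv ?A ** H \<in> RH_inf" "G ** matrix_inv ?A \<in> RH_inf" "G ** matrix_inv ?A ** H \<in> RH_inf"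
    by (intro RH_inf_mult S assms)+
  with S have "feedback G H \<in> RH_inf"
    by (auto simp: feedback_def Let_def RH_inf_iff block_matrix_def split: sum.splits)
  with nz' show ?thesis
    by (simp add: closed_loop_stable_def invertible_det_nz)
qed

section \<open>Homotopies of holomorphic functions without zeros on the circle\<close>

lemma min_modulus_disc:
  fixes f :: "complex \<Rightarrow> complex"
  assumes "continuous_on (cball 0 1) f" "f holomorphic_on ball 0 1"
    and "\<And>z. z \<in> cball 0 1 \<Longrightarrow> f z \<noteq> 0"
    and "d > 0" "\<And>z. z \<in> sphere 0 1 \<Longrightarrow> d \<le> norm (f z)"
    and "z \<in> cball 0 1"
  shows "d \<le> norm (f z)"
proof -
  have "norm (inverse (f z)) \<le> inverse d"
  proof (rule maximum_modulus_frontier [of "\<lambda>z. inverse (f z)" "cball 0 1"])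
    show "(\<lambda>z. inverse (f z)) holomorphic_on interior (cball 0 1)"
      using assms(2,3) by (auto intro!: holomorphic_intros)
    show "continuous_on (closure (cball 0 1)) (\<lambda>z. inverse (f z))"
      using assms(1,3) by (auto intro!: continuous_intros)
    show "norm (inverse (f w)) \<le> inverse d" if "w \<in> frontier (cball 0 1)" for w
      using that assms(4) assms(5) [of w] by (auto simp: norm_inverse intro: le_imp_inverse_le)
  qed (use assms in auto)
  then have "inverse (norm (f z)) \<le> inverse d" by (simp add: norm_inverse)
  then show ?thesis
    using assms(3) [OF assms(6)] assms(4) by (metis inverse_le_imp_le inverse_positive_iff_positive zero_less_norm_iff)
qed

text \<open>The lower bound \<open>d\<close> on the circle is uniform in \<open>t\<close>, and so is
  the modulus of continuity. Nonvanishing therefore propagates from \<open>t = 0\<close> to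
  \<open>t = 1\<close> in finitely many steps of fixed length.\<close>

lemma homotopy_nonvanishing_disc:
  fixes F :: "real \<Rightarrow> complex \<Rightarrow> complex"
  assumes cont: "continuous_on ({0..1} \<times> cball 0 1) (\<lambda>(t, z). F t z)"
    and hol: "\<And>t. t \<in> {0..1} \<Longrightarrow> F t holomorphic_on ball 0 1"
    and bdry: "\<And>t z. t \<in> {0..1} \<Longrightarrow> z \<in> sphere 0 1 \<Longrightarrow> F t z \<noteq> 0"
    and init: "\<And>z. z \<in> cball 0 1 \<Longrightarrow> F 0 z \<noteq> 0"
    and z: "z \<in> cball 0 1"
  shows "F 1 z \<noteq> 0"
proof -
  let ?K = "{0..1::real} \<times> cball (0::complex) 1"
  have contF: "continuous_on (cball 0 1) (F t)" if "t \<in> {0..1}" for t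
    using continuous_on_compose2 [OF cont, of "cball 0 1" "\<lambda>z. (t, z)"] that
    by (simp add: continuous_on_Pair image_subset_iff)
  \<comment> \<open>By compactness the modulus attains a minimum on the product of the interval and
    the circle, and \<open>bdry\<close> makes it positive.\<close>
  obtain d where d: "d > 0" "\<And>t z. t \<in> {0..1} \<Longrightarrow> z \<in> sphere 0 1 \<Longrightarrow> d \<le> norm (F t z)"
  proof -
    have "compact ({0..1::real} \<times> sphere (0::complex) 1)"
      by (intro compact_Times) auto
    moreover have "continuous_on ({0..1} \<times> sphere 0 1) (\<lambda>p. norm ((\<lambda>(t, z). F t z) p))"
      by (intro continuous_on_norm continuous_on_subset [OF cont]) auto
    moreover have "(0, 1) \<in> {0..1::real} \<times> sphere (0::complex) 1" by simp
    ultimately obtain p where p: "p \<in> {0..1} \<times> sphere 0 1"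
      "\<And>q. q \<in> {0..1} \<times> sphere 0 1 \<Longrightarrow> norm ((\<lambda>(t, z). F t z) p) \<le> norm ((\<lambda>(t, z). F t z) q)"
      using continuous_attains_inf [of "{0..1::real} \<times> sphere (0::complex) 1"
          "\<lambda>p. norm ((\<lambda>(t, z). F t z) p)"] by blast
    obtain t0 z0 where [simp]: "p = (t0, z0)" by (cases p)
    show thesis
    proof (rule that [of "norm (F t0 z0)"])
      show "norm (F t0 z0) > 0" using p(1) bdry by simp
      show "norm (F t0 z0) \<le> norm (F t z)" if "t \<in> {0..1}" "z \<in> sphere 0 1" for t z
        using p(2) [of "(t, z)"] that by simp
    qed
  qed
  have "uniformly_continuous_on ?K (\<lambda>(t, z). F t z)"
    using cont by (intro compact_uniformly_continuous compact_Times) auto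
  then obtain e where e: "e > 0" and close: "\<And>p q. p \<in> ?K \<Longrightarrow> q \<in> ?K \<Longrightarrow> dist q p < e \<Longrightarrow>
      dist ((\<lambda>(t, z). F t z) q) ((\<lambda>(t, z). F t z) p) < d"
    unfolding uniformly_continuous_on_def using d(1) by metis
  have low: "\<forall>z\<in>cball 0 1. d \<le> norm (F t z)"
    if "t \<in> {0..1}" "\<And>z. z \<in> cball 0 1 \<Longrightarrow> F t z \<noteq> 0" for t
    using min_modulus_disc [OF contF hol] that d by blast
  \<comment> \<open>The invariant is the quantitative bound \<open>d\<close>, not mere nonvanishing:
    a change smaller than \<open>d\<close> then cannot produce a zero.\<close>
  have steps: "\<forall>t\<in>{0..1}. t \<le> real n * (e / 2) \<longrightarrow> (\<forall>z\<in>cball 0 1. d \<le> norm (F t z))" for n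
  proof (induction n)
    case 0
    show ?case using low [of 0] init by auto
  next
    case (Suc n)
    show ?case
    proof (intro ballI impI)
      fix t z assume t: "t \<in> {0..1::real}" "t \<le> real (Suc n) * (e / 2)" and z: "z \<in> cball (0::complex) 1"
      \<comment> \<open>The parameter one step back, cut off at 0; steps of \<open>e / 2\<close>
        keep the distance strictly below \<open>e\<close>.\<close>
      define u where "u = max 0 (t - e / 2)"
      have "0 \<le> real n * (e / 2)" "t - e / 2 \<le> real n * (e / 2)"
        using t e by (simp_all add: distrib_right)
      then have "u \<le> real n * (e / 2)"
        unfolding u_def by (rule max.boundedI)
      moreover have "u \<in> {0..1}" "dist t u < e"
        using t e by (auto simp: u_def dist_real_def)
      ultimately have u: "u \<in> {0..1}" "u \<le> real n * (e / 2)" "dist t u < e"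
        by blast+
      have "F t w \<noteq> 0" if "w \<in> cball 0 1" for w
      proof
        assume "F t w = 0"
        moreover have "d \<le> norm (F u w)" using Suc.IH u that by blast
        moreover have "dist (F t w) (F u w) < d"
          using close [of "(u, w)" "(t, w)"] u t that by (simp add: dist_Pair_Pair)
        ultimately show False by (simp add: dist_norm)
      qed
      with low t z show "d \<le> norm (F t z)" by blast
    qed
  qed
  obtain n :: nat where "2 / e < real n" using reals_Archimedean2 by blast
  then have "1 \<le> real n * (e / 2)" using e by (simp add: field_simps)
  then have "d \<le> norm (F 1 z)" using steps [of n] z by auto
  with d(1) show ?thesis by auto
qed

section \<open>The closed right half-plane as a disc\<close>

text \<open>A bijection from the closed unit disc without 1 to the closed right half-plane that
  takes the circle to the imaginary axis. The point 1 corresponds to infinity, although division by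
  zero gives \<open>cayley 1 = 0\<close>.\<close>

definition cayley :: "complex \<Rightarrow> complex" where
  "cayley z = (1 + z) / (1 - z)"

text \<open>The numerator is multiplied by the conjugate of the denominator. The formula covers
  \<open>z = 1\<close> as well, where both sides are 0.\<close>

lemma Re_cayley: "Re (cayley z) = (1 - (norm z)\<^sup>2) / (norm (1 - z))\<^sup>2"
proof -
  have "Re (cayley z) = Re ((1 + z) * cnj (1 - z)) / (norm (1 - z))\<^sup>2"
    by (simp only: cayley_def complex_div_cnj [of "1 + z"] Re_divide_of_real)
  also have "Re ((1 + z) * cnj (1 - z)) = 1 - (norm z)\<^sup>2"
    unfolding cmod_power2 by (simp add: algebra_simps power2_eq_square)
  finally show ?thesis .
qed

lemma cayley_inverse:
  assumes "Re s \<ge> 0"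
  obtains z where "z \<in> cball 0 1" "z \<noteq> 1" "cayley z = s"
proof
  have s1: "s + 1 \<noteq> 0" using assms by (auto simp: complex_eq_iff)
  let ?z = "(s - 1) / (s + 1)"
  show "?z \<noteq> 1" using s1 by (simp add: field_simps)
  have "1 - ?z = 2 / (s + 1)" "1 + ?z = 2 * s / (s + 1)"
    using s1 by (simp_all add: field_simps)
  then show "cayley ?z = s" using s1 by (simp add: cayley_def)
  \<comment> \<open>A point of the closed right half-plane is at least as close to 1 as to
    -1.\<close>
  have "(norm (s - 1))\<^sup>2 \<le> (norm (s + 1))\<^sup>2"
    using assms unfolding cmod_power2 by (simp add: algebra_simps power2_eq_square)
  then have "norm (s - 1) \<le> norm (s + 1)" by (simp add: power2_le_iff_abs_le)
  then show "?z \<in> cball 0 1" using s1 by (simp add: norm_divide divide_simps)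
qed

lemma filterlim_cayley: "filterlim cayley at_infinity (at 1)"
  unfolding cayley_def [abs_def]
proof (rule filterlim_divide_at_infinity)
  show "((\<lambda>z. 1 + z) \<longlongrightarrow> (2::complex)) (at 1)"
    by (auto intro!: tendsto_eq_intros)
  show "filterlim (\<lambda>z. 1 - z) (at 0) (at (1::complex))"
    by (rule filterlim_atI) (auto intro!: tendsto_eq_intros simp: eventually_at_filter)
qed simp

definition disc_eval :: "real poly fract \<Rightarrow> complex \<Rightarrow> complex" where
  "disc_eval f z = (if z = 1 then tf_inf f else tf_eval f (cayley z))"

lemma Re_cayley_nonneg: "z \<in> cball 0 1 \<Longrightarrow> Re (cayley z) \<ge> 0"
  by (simp add: Re_cayley power_le_one)

text \<open>At 1, continuity is convergence at infinity, which is properness; elsewhere stability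
  keeps the denominator away from 0.\<close>

lemma continuous_disc_eval:
  assumes "f \<in> RH_scalars"
  shows "continuous_on (cball 0 1) (disc_eval f)"
  unfolding continuous_on_eq_continuous_within
proof
  fix z :: complex assume z: "z \<in> cball 0 1"
  show "continuous (at z within cball 0 1) (disc_eval f)"
  proof (cases "z = 1")
    case True
    have "((\<lambda>z. tf_eval f (cayley z)) \<longlongrightarrow> tf_inf f) (at 1)"
      using assms by (intro filterlim_compose [OF tf_eval_tendsto_inf filterlim_cayley])
        (simp add: RH_scalars_def)
    then have "((\<lambda>z. tf_eval f (cayley z)) \<longlongrightarrow> tf_inf f) (at 1 within cball 0 1)"
      by (rule tendsto_within_subset) simp
    then have "(disc_eval f \<longlongrightarrow> tf_inf f) (at 1 within cball 0 1)"
      by (rule Lim_transform_eventually) (auto simp: eventually_at_filter disc_eval_def)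
    then show ?thesis
      using True by (simp add: continuous_within disc_eval_def)
  next
    case False
    have "cpoly (tf_den f) (cayley z) \<noteq> 0"
      using assms Re_cayley_nonneg [OF z] by (simp add: RH_scalars_def stable_tf_def)
    then have "isCont (\<lambda>z. tf_eval f (cayley z)) z"
      using False unfolding tf_eval_def cpoly_def cayley_def
      by (auto intro!: continuous_intros)
    then have "isCont (disc_eval f) z"
    proof (rule isCont_cong [THEN iffD1, rotated])
      show "\<forall>\<^sub>F w in nhds z. tf_eval f (cayley w) = disc_eval f w"
        unfolding eventually_nhds
        by (rule exI [of _ "- {1}"]) (use False in \<open>auto simp: disc_eval_def\<close>)
    qed
    then show ?thesis by (rule continuous_at_imp_continuous_at_within)
  qed
qed

lemma holomorphic_disc_eval:
  assumes "f \<in> RH_scalars"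
  shows "disc_eval f holomorphic_on ball 0 1"
proof -
  have "(\<lambda>z. tf_eval f (cayley z)) holomorphic_on ball 0 1"
  proof -
    have "cpoly (tf_den f) (cayley z) \<noteq> 0" if "z \<in> ball 0 1" for z
      using assms Re_cayley_nonneg [of z] that by (simp add: RH_scalars_def stable_tf_def)
    moreover have "1 - z \<noteq> 0" if "z \<in> ball 0 1" for z :: complex using that by auto
    then have "cayley holomorphic_on ball 0 1"
      unfolding cayley_def [abs_def] by (intro holomorphic_intros) auto
    then have "(\<lambda>z. cpoly p (cayley z)) holomorphic_on ball 0 1" for p
      using holomorphic_on_compose_gen [OF _ holomorphic_cpoly [of p UNIV], of cayley]
      by (simp add: o_def)
    ultimately show ?thesis
      unfolding tf_eval_def by (intro holomorphic_on_divide)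
  qed
  then show ?thesis
    by (rule holomorphic_transform) (auto simp: disc_eval_def)
qed

section \<open>The frequency response and stability from nonvanishing determinants\<close>

lemma freq_resp_infinity:
  assumes "G \<in> RH_inf"
  shows "freq_resp G \<infinity> = (\<chi> i k. tf_inf (G $ i $ k))"
proof -
  have "Lim at_top (\<lambda>t::real. tf_eval f (\<i> * complex_of_real t)) = tf_inf f" if "proper_tf f" for f
  proof (rule tendsto_Lim)
    have "filterlim (\<lambda>t::real. \<i> * complex_of_real t) at_infinity at_top"
      by (intro tendsto_mult_filterlim_at_infinity [OF tendsto_const]
          filterlim_compose [OF filterlim_of_real_at_infinity]) (auto simp: filterlim_ident)
    then show "((\<lambda>t. tf_eval f (\<i> * complex_of_real t)) \<longlongrightarrow> tf_inf f) at_top"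
      by (rule filterlim_compose [OF tf_eval_tendsto_inf [OF that]])
  qed simp
  with assms show ?thesis
    by (simp add: freq_resp_def RH_inf_def)
qed

lemma freq_resp_ereal: "freq_resp G (ereal t) = mat_eval G (\<i> * complex_of_real t)"
  by (simp add: freq_resp_def mat_eval_def)

definition disc_mat :: "('n::finite) tf_matrix \<Rightarrow> complex \<Rightarrow> complex ^ 'n ^ 'n" where
  "disc_mat G z = (\<chi> i k. disc_eval (G $ i $ k) z)"

text \<open>The Leibniz expansion exhibits a polynomial in \<open>t\<close> and the entries, from
  which continuity, holomorphy and the behaviour under conjugation can be read off.\<close>

lemma det_add_scaleR_mult:
  fixes A B :: "complex ^ ('n::finite) ^ 'n"
  shows "det (mat 1 + t *\<^sub>R (A ** B)) = (\<Sum>p | p permutes UNIV. of_int (sign p) *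
    (\<Prod>i\<in>UNIV. (if i = p i then 1 else 0) + of_real t * (\<Sum>l\<in>UNIV. A $ i $ l * B $ l $ p i)))"
  by (simp add: det_def mat_def matrix_matrix_mult_def scaleR_conv_of_real [where 'a = complex]
      cong: if_cong)

text \<open>The coefficients of the transfer functions are real. This reduces negative frequencies
  to positive ones.\<close>

lemma det_add_scaleR_mult_cnj:
  "det (mat 1 + t *\<^sub>R (mat_eval A (cnj s) ** mat_eval B (cnj s))) =
    cnj (det (mat 1 + t *\<^sub>R (mat_eval A s ** mat_eval B s)))"
proof -
  have "cnj (if P then 1 else 0) = (if P then 1 else 0)" for P by simp
  then show ?thesis
    unfolding det_add_scaleR_mult
    by (simp add: mat_eval_def tf_eval_cnj cnj_sum cnj_prod del: complex_cnj_one complex_cnj_zero)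
qed

text \<open>The homotopy scales the loop gain by \<open>t\<close>. On the circle, the point 1 stands
  for infinite frequency and all other points for the imaginary axis, whose lower half is handled by
  conjugation.\<close>

lemma closed_loop_stable_if_det_nonzero:
  assumes "G \<in> RH_inf" "H \<in> RH_inf"
    and nz: "\<And>\<omega> \<tau>. \<omega> \<in> {0..\<infinity>} \<Longrightarrow> \<tau> \<in> {0<..1} \<Longrightarrow>
      det (mat 1 + \<tau> *\<^sub>R (freq_resp H \<omega> ** freq_resp G \<omega>)) \<noteq> 0"
  shows "closed_loop_stable G H"
proof -
  have ent: "G $ i $ k \<in> RH_scalars" "H $ i $ k \<in> RH_scalars" for i k
    using assms by (simp_all add: RH_inf_iff)
  define F where "F t z = det (mat 1 + t *\<^sub>R (disc_mat H z ** disc_mat G z))" for t z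
  have disc_mat_1: "disc_mat G 1 = freq_resp G \<infinity>" "disc_mat H 1 = freq_resp H \<infinity>"
    using assms by (simp_all add: freq_resp_infinity disc_mat_def disc_eval_def)
  have disc_mat: "disc_mat A z = mat_eval A (cayley z)" if "z \<noteq> 1" for A :: "'a tf_matrix" and z
    using that by (simp add: disc_mat_def mat_eval_def disc_eval_def)
  have nz_axis: "det (mat 1 + t *\<^sub>R (mat_eval H s ** mat_eval G s)) \<noteq> 0"
    if "Re s = 0" "t \<in> {0<..1}" for s t
  proof (cases "Im s \<ge> 0")
    case True
    have "s = \<i> * complex_of_real (Im s)" using that by (simp add: complex_eq_iff)
    then show ?thesis
      using nz [of "ereal (Im s)" t] True that by (simp add: freq_resp_ereal)
  next
    case False
    have "cnj s = \<i> * complex_of_real (- Im s)" using that by (simp add: complex_eq_iff)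
    then have "det (mat 1 + t *\<^sub>R (mat_eval H (cnj s) ** mat_eval G (cnj s))) \<noteq> 0"
      using nz [of "ereal (- Im s)" t] False that by (simp add: freq_resp_ereal)
    then show ?thesis
      by (simp add: det_add_scaleR_mult_cnj)
  qed
  have F1: "F 1 z \<noteq> 0" if "z \<in> cball 0 1" for z
  proof (rule homotopy_nonvanishing_disc [OF _ _ _ _ that])
    have c: "continuous_on ({0..1} \<times> cball 0 1) (\<lambda>p. disc_eval f (snd p))" if "f \<in> RH_scalars" for f
      by (rule continuous_on_compose2 [OF continuous_disc_eval [OF that]])
        (auto intro!: continuous_intros)
    show "continuous_on ({0..1} \<times> cball 0 1) (\<lambda>(t, z). F t z)"
      unfolding F_def det_add_scaleR_mult disc_mat_def split_beta
      by (auto intro!: continuous_intros c ent)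
    show "F t holomorphic_on ball 0 1" for t
      unfolding F_def [abs_def] det_add_scaleR_mult disc_mat_def
      by (auto intro!: holomorphic_intros holomorphic_disc_eval ent)
    show F0: "F 0 z \<noteq> 0" for z by (simp add: F_def)
    show "F t z \<noteq> 0" if "t \<in> {0..1}" "z \<in> sphere 0 1" for t z
    proof (cases "t = 0")
      case False
      then have t: "t \<in> {0<..1}" using that by simp
      show ?thesis
      proof (cases "z = 1")
        case True
        then show ?thesis using nz [of \<infinity> t] t by (simp add: F_def disc_mat_1)
      next
        case False
        have "Re (cayley z) = 0" using that by (simp add: Re_cayley)
        with nz_axis t False show ?thesis by (simp add: F_def disc_mat)
      qed
    qed (use F0 in simp)
  qed
  show ?thesis
  proof (rule closed_loop_stableI [OF assms(1,2)])
    show nz': "det (mat 1 + mat_eval H s ** mat_eval G s) \<noteq> 0" if "Re s \<ge> 0" for s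
    proof -
      obtain z where "z \<in> cball 0 1" "z \<noteq> 1" "cayley z = s" using cayley_inverse [OF \<open>Re s \<ge> 0\<close>] .
      then show ?thesis using F1 [of z] by (simp add: F_def disc_mat)
    qed
    let ?A = "mat 1 + H ** G"
    have A: "?A \<in> RH_inf"
      by (intro RH_inf_add RH_inf_mult RH_inf_mat_1 assms)
    then have d: "det ?A \<in> RH_scalars"
      by (simp add: RH_inf_iff RH_scalars_det)
    \<comment> \<open>The value at infinity of the determinant is identified by continuity:
      \<open>F 1\<close> and \<open>disc_eval (det ?A)\<close> are continuous on the disc and agree
      off 1, hence also at 1.\<close>
    have eq: "F 1 z = disc_eval (det ?A) z" if "z \<in> cball 0 1 - {1}" for z
      using that A assms Re_cayley_nonneg [of z]
      by (simp add: F_def disc_mat disc_eval_def RH_inf_iff [of ?A] tf_eval_det mat_eval_add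
          mat_eval_mult mat_eval_mat_1 RH_inf_mult RH_inf_mat_1)
    have "continuous_on (cball 0 1) (F 1)"
      unfolding F_def [abs_def] det_add_scaleR_mult disc_mat_def
      by (auto intro!: continuous_intros continuous_disc_eval ent)
    moreover have one: "1 \<in> cball (0::complex) 1" by simp
    ultimately have "(F 1 \<longlongrightarrow> F 1 1) (at 1 within cball 0 1)"
      by (simp add: continuous_on)
    moreover have "(disc_eval (det ?A) \<longlongrightarrow> disc_eval (det ?A) 1) (at 1 within cball 0 1)"
      using continuous_disc_eval [OF d] one by (simp add: continuous_on)
    then have "(F 1 \<longlongrightarrow> disc_eval (det ?A) 1) (at 1 within cball 0 1)"
      by (rule Lim_transform_eventually) (auto simp: eventually_at_filter eq)
    moreover have "at (1::complex) within cball 0 1 \<noteq> bot"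
      using islimpt_ball [of 1 "0::complex" 1] islimpt_subset [OF _ ball_subset_cball]
      by (auto simp: trivial_limit_within)
    ultimately have "F 1 1 = disc_eval (det ?A) 1"
      using tendsto_unique by blast
    then show "tf_inf (det ?A) \<noteq> 0" using F1 [of 1] by (simp add: disc_eval_def)
  qed
qed

section \<open>The Hermitian inner product\<close>

text \<open>The complex inner product, conjugate-linear in the first argument; \<open>inner\<close>
  on complex vectors is only its real part.\<close>

definition cdot :: "complex ^ 'n \<Rightarrow> complex ^ 'n \<Rightarrow> complex" where
  "cdot x y = (\<Sum>i\<in>UNIV. cnj (x $ i) * y $ i)"

lemma cdot_simps:
  "cdot (x + y) z = cdot x z + cdot y z" "cdot x (y + z) = cdot x y + cdot x z"
  "cdot (x - y) z = cdot x z - cdot y z" "cdot x (y - z) = cdot x y - cdot x z"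
  "cdot (c *s x) y = cnj c * cdot x y" "cdot x (c *s y) = c * cdot x y"
  "cdot (- x) y = - cdot x y" "cdot x (- y) = - cdot x y"
  by (simp_all add: cdot_def sum.distrib sum_subtractf sum_negf sum_distrib_left algebra_simps)

lemma cdot_0 [simp]: "cdot 0 x = 0" "cdot x 0 = 0"
  by (simp_all add: cdot_def)

lemma cdot_sum_right: "cdot x (sum f I) = (\<Sum>i\<in>I. cdot x (f i))"
  by (simp add: cdot_def sum_component sum_distrib_left sum.swap [of _ I])

lemma cnj_cdot: "cnj (cdot x y) = cdot y x"
  by (simp add: cdot_def mult.commute)

lemma cdot_self: "cdot x x = of_real ((norm x)\<^sup>2)"
  by (simp add: cdot_def norm_vec_def L2_set_def sum_nonneg complex_norm_square mult.commute
      flip: of_real_power)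

lemma inner_eq_Re_cdot: "inner x y = Re (cdot x y)"
  by (simp add: cdot_def inner_vec_def inner_complex_def)

lemma cdot_eq_0_imp: "(\<And>x. cdot x y = 0) \<Longrightarrow> y = 0"
  using cdot_self [of y] by simp

lemma cdot_ctranspose: "cdot (ctranspose A *v x) y = cdot x (A *v y)"
  by (simp add: cdot_def ctranspose_def matrix_vector_mult_def sum_distrib_left sum_distrib_right
      mult_ac) (subst sum.swap, rule refl)

lemma ctranspose_ctranspose [simp]: "ctranspose (ctranspose A) = A"
  by (simp add: ctranspose_def vec_eq_iff)

lemma ctranspose_mult: "ctranspose (A ** B) = ctranspose B ** ctranspose A"
  by (simp add: ctranspose_def matrix_matrix_mult_def vec_eq_iff mult.commute)

lemma ctranspose_mat_1 [simp]: "ctranspose (mat 1) = mat 1"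
  by (simp add: ctranspose_def mat_def vec_eq_iff)

lemma cdot_hermitian: "ctranspose A = A \<Longrightarrow> cdot x (A *v y) = cnj (cdot y (A *v x))"
  by (metis cdot_ctranspose cnj_cdot)

lemma cdot_hermitian_real: "ctranspose A = A \<Longrightarrow> cdot x (A *v x) = of_real (Re (cdot x (A *v x)))"
  by (metis cdot_hermitian complex_cnj_cancel_iff Reals_cnj_iff of_real_Re)

lemma scaleR_matrix_vector: "(r *\<^sub>R A) *v x = complex_of_real r *s (A *v x)"
  by (simp add: vec_eq_iff matrix_vector_mult_def scaleR_conv_of_real [where 'a = complex]
      sum_distrib_left mult_ac)

lemma cmod_square: "(complex_of_real (cmod c))\<^sup>2 = c * cnj c"
  by (metis complex_norm_square of_real_power)

lemma norm_vector_scalar: "norm (c *s x) = cmod c * norm (x :: complex ^ 'n)"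
proof -
  have "complex_of_real ((norm (c *s x))\<^sup>2) = of_real ((cmod c * norm x)\<^sup>2)"
    unfolding cdot_self [symmetric] cdot_simps
    by (simp add: cdot_self power_mult_distrib cmod_square mult.commute)
  then have "(norm (c *s x))\<^sup>2 = (cmod c * norm x)\<^sup>2"
    using of_real_eq_iff by blast
  then show ?thesis by simp
qed

lemma qform_eq_cdot: "qform A x = cdot x (A *v x)"
  by (simp add: qform_def cdot_def)

lemma qform_scale: "qform A (c *s x) = of_real ((cmod c)\<^sup>2) * qform A x"
  by (simp add: qform_eq_cdot vector_scalar_commute cdot_simps complex_norm_square mult_ac
      flip: of_real_power)

lemma qform_combination:
  "qform A (c *s x + d *s y) = of_real ((cmod c)\<^sup>2) * qform A x + of_real ((cmod d)\<^sup>2) * qform A y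
    + cnj c * d * cdot x (A *v y) + cnj d * c * cdot y (A *v x)"
  by (simp add: qform_eq_cdot vector_scalar_commute matrix_vector_right_distrib cdot_simps
      complex_norm_square algebra_simps flip: of_real_power)

lemma continuous_on_matrix_vector [continuous_intros]:
  fixes A :: "complex ^ 'n ^ 'm"
  shows "continuous_on S f \<Longrightarrow> continuous_on S (\<lambda>x. A *v f x)"
  unfolding matrix_vector_mult_def by (intro continuous_intros)

lemma continuous_on_vector_scalar [continuous_intros]:
  "continuous_on S f \<Longrightarrow> continuous_on S g \<Longrightarrow> continuous_on S (\<lambda>x. (f x :: complex) *s g x)"
  unfolding vector_scalar_mult_def by (intro continuous_intros)

lemma continuous_on_cdot [continuous_intros]:
  "continuous_on S f \<Longrightarrow> continuous_on S g \<Longrightarrow> continuous_on S (\<lambda>x. cdot (f x) (g x))"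
  unfolding cdot_def by (intro continuous_intros)

lemma norm_normalized:
  "x \<noteq> 0 \<Longrightarrow> norm (inverse (of_real (norm x)) *s (x :: complex ^ 'n)) = 1"
  by (simp add: norm_vector_scalar norm_inverse)


section \<open>Semidefinite forms and singular values\<close>

text \<open>A first-order argument: if \<open>cdot x (B *v v)\<close> were nonzero, a small move
  from \<open>v\<close> in a suitable complex multiple of \<open>x\<close> would make the form
  negative. Semidefiniteness is assumed only along these directions, so the lemma applies on
  subspaces.\<close>

lemma semidefinite_null_vector:
  assumes herm: "ctranspose B = B"
    and pos: "\<And>c. Re (qform B (v + c *s x)) \<ge> 0" and x: "Re (qform B x) \<ge> 0"
    and null: "Re (qform B v) = 0"
  shows "cdot x (B *v v) = 0"
proof (rule ccontr)
  let ?w = "cdot x (B *v v)" and ?q = "Re (qform B x)"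
  assume w: "?w \<noteq> 0"
  \<comment> \<open>This choice gives \<open>t * ?q < 1\<close>, so that the linear term outweighs
    the quadratic one.\<close>
  define t where "t = 1 / (?q + 1)"
  have t: "t > 0" "t * ?q < 1"
    using x by (simp_all add: t_def)
  have vx: "cdot v (B *v x) = cnj ?w"
    using cdot_hermitian [OF herm] by blast
  have "qform B (v + (- of_real t * ?w) *s x) =
      qform B v + of_real (t\<^sup>2 * (cmod ?w)\<^sup>2) * qform B x - 2 * of_real (t * (cmod ?w)\<^sup>2)"
    using qform_combination [of B 1 v "- of_real t * ?w" x]
    by (simp add: vx norm_mult power_mult_distrib cmod_square mult_ac)
  then have "Re (qform B (v + (- of_real t * ?w) *s x)) = t\<^sup>2 * (cmod ?w)\<^sup>2 * ?q - 2 * (t * (cmod ?w)\<^sup>2)"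
    using null by (simp flip: of_real_power of_real_mult)
  also have "\<dots> = t * (cmod ?w)\<^sup>2 * (t * ?q - 2)"
    by (simp add: power2_eq_square algebra_simps)
  also have "\<dots> < 0"
    using t w by (intro mult_pos_neg) auto
  finally show False using pos [of "- of_real t * ?w"] by linarith
qed

section \<open>Singular values and the norm bound\<close>

lemma cdot_gram: "cdot x ((ctranspose A ** A) *v x) = of_real ((norm (A *v x))\<^sup>2)"
  by (metis cdot_ctranspose cdot_self ctranspose_ctranspose matrix_vector_mul_assoc)

lemma gram_hermitian: "ctranspose (ctranspose A ** A) = ctranspose A ** A"
  by (simp add: ctranspose_mult)

text \<open>Eigenvectors of the hermitian matrix \<open>ctranspose A ** A\<close> for different
  eigenvalues are orthogonal, and a pairwise orthogonal set is finite. Finiteness gives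
  \<open>Max\<close> in \<open>max_sv\<close> its meaning.\<close>

lemma finite_singular_values: "finite (singular_values (A :: complex ^ 'n ^ 'n))"
proof -
  let ?M = "ctranspose A ** A"
  have "\<forall>\<sigma>\<in>singular_values A. \<exists>v. v \<noteq> 0 \<and> ?M *v v = of_real (\<sigma>\<^sup>2) *s v"
    by (auto simp: singular_values_def)
  then obtain v where v: "\<And>\<sigma>. \<sigma> \<in> singular_values A \<Longrightarrow> v \<sigma> \<noteq> 0"
    "\<And>\<sigma>. \<sigma> \<in> singular_values A \<Longrightarrow> ?M *v v \<sigma> = of_real (\<sigma>\<^sup>2) *s v \<sigma>"
    by metis
  have orth: "orthogonal (v \<sigma>) (v \<tau>)"
    if "\<sigma> \<in> singular_values A" "\<tau> \<in> singular_values A" "\<sigma> \<noteq> \<tau>" for \<sigma> \<tau>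
  proof -
    have "of_real (\<tau>\<^sup>2) * cdot (v \<sigma>) (v \<tau>) = cdot (v \<sigma>) (?M *v v \<tau>)"
      by (simp add: v(2) [OF that(2)] cdot_simps)
    also have "\<dots> = cnj (cdot (v \<tau>) (?M *v v \<sigma>))"
      by (rule cdot_hermitian [OF gram_hermitian])
    also have "\<dots> = of_real (\<sigma>\<^sup>2) * cdot (v \<sigma>) (v \<tau>)"
      by (simp add: v(2) [OF that(1)] cdot_simps cnj_cdot)
    finally have "(of_real (\<tau>\<^sup>2) - of_real (\<sigma>\<^sup>2)) * cdot (v \<sigma>) (v \<tau>) = 0"
      by (simp add: left_diff_distrib)
    \<comment> \<open>Singular values are nonnegative, so different ones have different
      squares.\<close>
    moreover have "\<tau>\<^sup>2 \<noteq> \<sigma>\<^sup>2"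
      using that by (auto simp: singular_values_def power2_eq_iff)
    then have "complex_of_real (\<tau>\<^sup>2) - of_real (\<sigma>\<^sup>2) \<noteq> 0"
      by (metis eq_iff_diff_eq_0 of_real_eq_iff)
    ultimately show ?thesis
      by (simp add: orthogonal_def inner_eq_Re_cdot)
  qed
  then have "pairwise orthogonal (v ` singular_values A)"
    by (auto simp: pairwise_def)
  then have "finite (v ` singular_values A)"
    by (rule pairwise_orthogonal_imp_finite)
  moreover have "inj_on v (singular_values A)"
    using orth v(1) by (metis inj_onI orthogonal_self)
  ultimately show ?thesis by (rule finite_imageD)
qed

text \<open>The maximum \<open>c\<close> of \<open>norm (A *v x)\<close> on the unit sphere is
  itself a singular value: \<open>B\<close>, that is \<open>c\<^sup>2\<close> times the identity
  minus the Gram matrix, is positive semidefinite and its form vanishes at a maximizer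
  \<open>v\<close>, hence \<open>B *v v = 0\<close>.\<close>

lemma norm_le_max_sv: "norm (A *v x) \<le> max_sv A * norm (x :: complex ^ 'n)"
proof -
  have "sphere (0 :: complex ^ 'n) 1 \<noteq> {}" by simp
  moreover have "continuous_on (sphere 0 1) (\<lambda>x. norm (A *v x))"
    by (intro continuous_intros)
  ultimately obtain v :: "complex ^ 'n" where "v \<in> sphere 0 1"
    and max: "\<And>y. y \<in> sphere 0 1 \<Longrightarrow> norm (A *v y) \<le> norm (A *v v)"
    using continuous_attains_sup [OF compact_sphere] by metis
  then have v: "norm v = 1" by simp
  define c where "c = norm (A *v v)"
  have le: "norm (A *v y) \<le> c * norm y" for y
  proof (cases "y = 0")
    case False
    then have "norm (A *v (inverse (of_real (norm y)) *s y)) \<le> c"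
      unfolding c_def by (intro max) (simp add: norm_normalized)
    then show ?thesis
      using False by (simp add: vector_scalar_commute norm_vector_scalar norm_inverse norm_divide field_simps)
  qed simp
  let ?M = "ctranspose A ** A"
  define B where "B = c\<^sup>2 *\<^sub>R mat 1 - ?M"
  have B: "B *v y = of_real (c\<^sup>2) *s y - ?M *v y" for y
    by (simp add: B_def matrix_vector_mult_diff_rdistrib scaleR_matrix_vector)
  have qB: "qform B y = of_real ((c * norm y)\<^sup>2 - (norm (A *v y))\<^sup>2)" for y
    by (simp add: qform_eq_cdot B cdot_simps cdot_self cdot_gram power_mult_distrib)
  have "ctranspose B = c\<^sup>2 *\<^sub>R mat 1 - ctranspose ?M"
    by (simp add: B_def ctranspose_def vec_eq_iff mat_def)
  then have herm: "ctranspose B = B"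
    by (simp add: gram_hermitian B_def)
  have pos: "Re (qform B y) \<ge> 0" for y
    using power_mono [OF le [of y] norm_ge_zero, of 2] by (simp add: qB)
  have "B *v v = 0"
  proof (rule cdot_eq_0_imp)
    show "cdot y (B *v v) = 0" for y
      by (rule semidefinite_null_vector [OF herm pos pos])
        (use v in \<open>simp add: qB c_def\<close>)
  qed
  then have "c \<in> singular_values A"
    using v by (auto simp: singular_values_def B c_def intro!: exI [of _ v])
  then have "c \<le> max_sv A"
    unfolding max_sv_def by (intro Max_ge finite_singular_values)
  then show ?thesis
    using le [of x] by (meson mult_right_mono norm_ge_zero order_trans)
qed


section \<open>Numerical range\<close>

text \<open>The Toeplitz-Hausdorff theorem. After a change of phase of \<open>x\<close>, the
  normalized form along the segment from \<open>e *s x\<close> to \<open>y\<close> stays on the line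
  through \<open>a\<close> and \<open>b\<close>, and the intermediate value theorem reaches each
  point between them.\<close>

lemma convex_num_range: "convex (num_range (A :: complex ^ 'n ^ 'n))"
  unfolding convex_alt
proof (intro ballI allI impI)
  fix a b and t :: real
  assume ab: "a \<in> num_range A" "b \<in> num_range A" and t: "0 \<le> t \<and> t \<le> 1"
  obtain x y where x: "a = qform A x" "norm x = 1" and y: "b = qform A y" "norm y = 1"
    using ab by (auto simp: num_range_def)
  show "(1 - t) *\<^sub>R a + t *\<^sub>R b \<in> num_range A"
  proof (cases "a = b")
    case True
    then have "(1 - t) *\<^sub>R a + t *\<^sub>R b = a"
      by (simp add: algebra_simps flip: scaleR_add_left)
    then show ?thesis using ab by simp
  next
    case False
    define c where "c = b - a"
    have c: "c \<noteq> 0" using False by (simp add: c_def)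
    \<comment> \<open>\<open>g\<close> and \<open>h\<close> are the cross terms for the affinely
      normalized matrix \<open>(A - a) / c\<close>, whose form takes the values 0 at
      \<open>x\<close> and 1 at \<open>y\<close>.\<close>
    define g where "g = (cdot x (A *v y) - a * cdot x y) / c"
    define h where "h = (cdot y (A *v x) - a * cdot y x) / c"
    define w where "w = h - cnj g"
    \<comment> \<open>The phase that makes \<open>e * w\<close> real and nonnegative, which makes
      the total cross term real; for \<open>w = 0\<close> any phase works, but the quotient would be
      0.\<close>
    define e where "e = (if w = 0 then 1 else cnj w / of_real (cmod w))"
    have e: "cmod e = 1" by (simp add: e_def norm_divide)
    have "e * w = of_real (cmod w)"
      by (auto simp: e_def complex_norm_square power2_eq_square divide_simps mult.commute
          simp flip: of_real_mult) (metis complex_norm_square power2_eq_square)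
    moreover have "Im (cnj e * g + e * h) = Im (e * w)"
      by (simp add: w_def algebra_simps)
    ultimately have real: "Im (cnj e * g + e * h) = 0" by simp
    define p where "p s = (of_real (1 - s) * e) *s x + of_real s *s y" for s :: real
    have qp: "qform A (p s) = a * of_real ((norm (p s))\<^sup>2) +
        c * of_real (s\<^sup>2 + (1 - s) * s * Re (cnj e * g + e * h))" for s
    proof -
      have q1: "qform (mat 1) z = of_real ((norm z)\<^sup>2)" for z :: "complex ^ 'n"
        by (simp add: qform_eq_cdot cdot_self)
      have gh: "cdot x (A *v y) = a * cdot x y + c * g" "cdot y (A *v x) = a * cdot y x + c * h"
        using c by (simp_all add: g_def h_def)
      have ce: "cmod (of_real r * e) = \<bar>r\<bar>" for r by (simp add: norm_mult e)
      have "qform A (p s) - a * qform (mat 1) (p s) =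
          c * (of_real (s\<^sup>2) + of_real ((1 - s) * s) * (cnj e * g + e * h))"
        unfolding p_def qform_combination ce
        using x y by (simp add: q1 gh c_def norm_mult algebra_simps)
      moreover have "cnj e * g + e * h = of_real (Re (cnj e * g + e * h))"
        using real by (simp add: complex_eq_iff)
      ultimately show ?thesis
        unfolding q1 by (metis add.commute diff_eq_eq of_real_add of_real_mult)
    qed
    \<comment> \<open>A zero of \<open>\<Phi>\<close> at \<open>s\<close> means that the normalized
      form at \<open>p s\<close> is \<open>a + c * t\<close>. The end values are \<open>- t\<close>
      and \<open>1 - t\<close>.\<close>
    define \<Phi> where "\<Phi> s = s\<^sup>2 + (1 - s) * s * Re (cnj e * g + e * h) - t * (norm (p s))\<^sup>2" for s
    have "continuous_on {0..1} \<Phi>"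
      unfolding \<Phi>_def p_def by (intro continuous_intros)
    moreover have "norm (p 0) = 1" "norm (p 1) = 1"
      using x y e by (simp_all add: p_def norm_vector_scalar)
    then have "\<Phi> 0 \<le> 0" "0 \<le> \<Phi> 1" using t by (simp_all add: \<Phi>_def)
    ultimately obtain s where s: "0 \<le> s" "s \<le> 1" "\<Phi> s = 0"
      using IVT' [of \<Phi> 0 0 1] by auto
    \<comment> \<open>If \<open>p s\<close> vanished, comparing norms would give
      \<open>s = 1 / 2\<close>; then \<open>x\<close> and \<open>y\<close> differ by a phase only,
      contradicting \<open>a \<noteq> b\<close>.\<close>
    have p_nz: "p s \<noteq> 0"
    proof
      assume "p s = 0"
      then have eq: "(of_real (1 - s) * e) *s x = (- of_real s) *s y"
        by (simp add: p_def add_eq_0_iff vector_smult_lneg)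
      then have "cmod (of_real (1 - s) * e) * norm x = cmod (- of_real s) * norm y"
        by (metis norm_vector_scalar)
      then have "1 - s = s" using s x y e by (simp add: norm_mult del: of_real_diff)
      then have "s = 1 / 2" by simp
      moreover have "of_real ((cmod (of_real (1 - s) * e))\<^sup>2) * a = of_real ((cmod (- of_real s))\<^sup>2) * b"
        unfolding x y by (metis eq qform_scale)
      moreover have "cmod (of_real (1 - s) * e) = 1 / 2" "cmod (- of_real s) = 1 / 2"
        using \<open>s = 1 / 2\<close> e by (simp_all add: norm_mult del: of_real_diff)
      ultimately have "of_real ((1 / 2)\<^sup>2) * a = of_real ((1 / 2)\<^sup>2) * b"
        by (simp only:)
      then show False using False by simp
    qed
    have "qform A (p s) = (a + c * of_real t) * of_real ((norm (p s))\<^sup>2)"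
      using s(3) unfolding qp \<Phi>_def by (simp add: algebra_simps)
    then have "qform A (inverse (of_real (norm (p s))) *s p s) = a + c * of_real t"
      using p_nz by (simp add: qform_scale power_divide norm_inverse norm_divide power2_eq_square field_simps)
    moreover have "(1 - t) *\<^sub>R a + t *\<^sub>R b = a + c * of_real t"
      by (simp add: c_def scaleR_conv_of_real algebra_simps)
    moreover have "qform A (inverse (of_real (norm (p s))) *s p s) \<in> num_range A"
      using norm_normalized [OF p_nz] by (auto simp: num_range_def)
    ultimately show ?thesis by simp
  qed
qed

lemma compact_num_range: "compact (num_range (A :: complex ^ 'n ^ 'n))"
proof -
  have "num_range A = qform A ` sphere 0 1"
    by (auto simp: num_range_def)
  moreover have "continuous_on (sphere 0 1) (qform A)"
    unfolding qform_eq_cdot [abs_def] by (intro continuous_intros)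
  ultimately show ?thesis
    by (simp add: compact_continuous_image)
qed

text \<open>The numerical range is compact and convex, so a line strictly separates it from 0;
  rotating its normal \<open>a\<close> to the positive real axis gives the claim on unit vectors,
  and scaling extends it.\<close>

lemma sectorial_rotation:
  assumes "sectorial (A :: complex ^ 'n ^ 'n)"
  obtains \<alpha> where "\<And>x. x \<noteq> 0 \<Longrightarrow> Re (cis (- \<alpha>) * qform A x) > 0"
proof -
  have "0 \<notin> num_range A" using assms by (simp add: sectorial_def)
  then obtain a b where ab: "a \<noteq> 0" "0 < b" "\<And>w. w \<in> num_range A \<Longrightarrow> inner a w > b"
    using separating_hyperplane_closed_0 [OF convex_num_range compact_imp_closed [OF compact_num_range], of A]
    by blast
  have "Re (cis (- Arg a) * qform A x) > 0" if "x \<noteq> 0" for x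
  proof -
    let ?y = "inverse (of_real (norm x)) *s x"
    have "qform A ?y \<in> num_range A"
      using norm_normalized [OF that] by (auto simp: num_range_def)
    then have "inner a (qform A ?y) > 0" using ab by fastforce
    moreover have "inner a z = cmod a * Re (cis (- Arg a) * z)" for z
    proof -
      have "inner a z = Re (cnj (rcis (cmod a) (Arg a)) * z)"
        by (simp add: rcis_cmod_Arg inner_complex_def)
      then show ?thesis
        by (simp add: rcis_def cis_cnj algebra_simps)
    qed
    ultimately have "Re (cis (- Arg a) * qform A ?y) > 0"
      using ab(1) by (simp add: zero_less_mult_iff)
    then show ?thesis
      using that by (simp add: qform_scale norm_inverse zero_less_mult_iff mult.left_commute [of "cis _"])
  qed
  with that show thesis by blast
qed

section \<open>Simultaneous diagonalization by congruence\<close>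

lemma exists_null_vector:
  assumes "det A = 0"
  obtains x where "x \<noteq> 0" "A *v x = (0 :: 'a::field ^ 'n)"
proof -
  have "\<not> invertible A" using assms by (simp add: invertible_det_nz)
  with that show thesis
    by (metis invertible_left_inverse matrix_left_invertible_ker)
qed

text \<open>The next generalized eigenvector minimizes the quotient of the forms of \<open>K\<close>
  and \<open>P\<close> over the \<open>P\<close>-orthogonal complement \<open>V\<close> of those
  already found. With \<open>\<mu>\<close> the minimum, \<open>B = K - \<mu> P\<close> is
  semidefinite on \<open>V\<close> and its form vanishes at the minimizer.\<close>

lemma simultaneous_diagonalization_step:
  fixes P K :: "complex ^ 'n ^ 'n" and v :: "'n \<Rightarrow> complex ^ 'n" and l :: "'n \<Rightarrow> real"
  assumes hP: "ctranspose P = P" and hK: "ctranspose K = K"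
    and pos: "\<And>x. x \<noteq> 0 \<Longrightarrow> Re (qform P x) > 0"
    and j: "j \<notin> I"
    and eig: "\<And>i. i \<in> I \<Longrightarrow> K *v v i = of_real (l i) *s (P *v v i)"
    and orth: "\<And>i k. i \<in> I \<Longrightarrow> k \<in> I \<Longrightarrow> cdot (v i) (P *v v k) = (if i = k then 1 else 0)"
  obtains w \<mu> where "K *v w = of_real \<mu> *s (P *v w)" "cdot w (P *v w) = 1"
    "\<And>i. i \<in> I \<Longrightarrow> cdot (v i) (P *v w) = 0"
proof -
  define V where "V = {x. \<forall>i\<in>I. cdot (v i) (P *v x) = 0}"
  obtain x0 where x0: "x0 \<in> V" "x0 \<noteq> 0"
  proof -
    \<comment> \<open>The orthogonality conditions form a square system whose row \<open>j\<close>
      is 0 because \<open>j\<close> lies outside \<open>I\<close>; hence it has a nontrivial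
      solution.\<close>
    define M where "M = (\<chi> r k. if r \<in> I then cnj ((P *v v r) $ k) else 0)"
    have "row j M = 0"
      using j by (simp add: M_def row_def vec_eq_iff)
    then obtain x where x: "x \<noteq> 0" "M *v x = 0"
      using exists_null_vector det_zero_row(2) by metis
    have "cdot (v i) (P *v x) = (M *v x) $ i" if "i \<in> I" for i
      using that cdot_ctranspose [of P "v i" x]
      by (simp add: hP cdot_def M_def matrix_vector_mult_def)
    with x show thesis by (intro that [of x]) (simp_all add: V_def)
  qed
  have V_scale: "c *s x \<in> V" if "x \<in> V" for c x
    using that by (simp add: V_def vector_scalar_commute cdot_simps)
  have V_add: "x + y \<in> V" if "x \<in> V" "y \<in> V" for x y
    using that by (simp add: V_def matrix_vector_right_distrib cdot_simps)
  let ?S = "V \<inter> sphere 0 1" and ?g = "\<lambda>x. Re (qform K x) / Re (qform P x)"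
  have "closed V"
  proof -
    have "V = (\<Inter>i\<in>I. {x. cdot (v i) (P *v x) = 0})" by (auto simp: V_def)
    moreover have "closed {x. cdot (v i) (P *v x) = 0}" for i
      by (intro closed_Collect_eq continuous_intros)
    ultimately show ?thesis by auto
  qed
  then have "compact ?S" by (simp add: compact_sphere closed_Int_compact)
  moreover have "inverse (of_real (norm x0)) *s x0 \<in> ?S"
    using V_scale [OF x0(1)] norm_normalized [OF x0(2)] by simp
  then have "?S \<noteq> {}" by blast
  moreover have "continuous_on ?S ?g"
  proof -
    have "Re (cdot x (P *v x)) \<noteq> 0" if "x \<in> ?S" for x
    proof -
      have "x \<noteq> 0" using that by auto
      then show ?thesis using pos [of x] by (simp add: qform_eq_cdot)
    qed
    then show ?thesis
      unfolding qform_eq_cdot by (intro continuous_intros) auto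
  qed
  ultimately obtain u where u: "u \<in> ?S" and min: "\<And>x. x \<in> ?S \<Longrightarrow> ?g u \<le> ?g x"
    using continuous_attains_inf [of ?S ?g] by blast
  have "u \<noteq> 0" "u \<in> V" using u by auto
  define \<mu> where "\<mu> = ?g u"
  define B where "B = K - \<mu> *\<^sub>R P"
  have B: "B *v x = K *v x - of_real \<mu> *s (P *v x)" for x
    by (simp add: B_def matrix_vector_mult_diff_rdistrib scaleR_matrix_vector)
  have qB: "qform B x = qform K x - of_real \<mu> * qform P x" for x
    by (simp add: qform_eq_cdot B cdot_simps)
  have "ctranspose B = ctranspose K - \<mu> *\<^sub>R ctranspose P"
    by (simp add: B_def ctranspose_def vec_eq_iff)
  then have hB: "ctranspose B = B"
    by (simp add: hP hK B_def)
  have posB: "Re (qform B x) \<ge> 0" if "x \<in> V" for x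
  proof (cases "x = 0")
    case False
    then have "inverse (of_real (norm x)) *s x \<in> ?S"
      using V_scale [OF that] norm_normalized by simp
    then have "\<mu> \<le> ?g (inverse (of_real (norm x)) *s x)"
      unfolding \<mu>_def by (rule min)
    then have "\<mu> \<le> ?g x"
      using False unfolding qform_scale by simp
    then show ?thesis
      using pos [OF False] by (simp add: qB field_simps)
  qed (simp add: qform_eq_cdot)
  have null: "Re (qform B u) = 0"
    using pos [OF \<open>u \<noteq> 0\<close>] by (simp add: qB \<mu>_def)
  have perpV: "cdot x (B *v u) = 0" if "x \<in> V" for x
    by (rule semidefinite_null_vector [OF hB])
      (use posB V_add V_scale that null \<open>u \<in> V\<close> in auto)
  \<comment> \<open>Moving the hermitian \<open>B\<close> onto the eigenvector \<open>v i\<close>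
    yields a real multiple of \<open>P *v v i\<close>, which is orthogonal to
    \<open>u\<close>.\<close>
  have perp_v: "cdot (v i) (B *v u) = 0" if "i \<in> I" for i
  proof -
    have "cdot (v i) (P *v u) = 0" using \<open>u \<in> V\<close> that by (simp add: V_def)
    then have "cdot u (P *v v i) = 0"
      by (subst cdot_hermitian [OF hP]) simp
    then have "cdot u (B *v v i) = 0"
      using eig [OF that] by (simp add: B cdot_simps)
    then show ?thesis
      by (subst cdot_hermitian [OF hB]) simp
  qed
  have "B *v u = 0"
  proof (rule cdot_eq_0_imp)
    fix x
    \<comment> \<open>The \<open>P\<close>-orthogonal projection of \<open>x\<close> onto the span
      of the vectors found so far; it splits \<open>x\<close> into a part in that span and a part in
      \<open>V\<close>.\<close>
    define y where "y = (\<Sum>i\<in>I. cdot (v i) (P *v x) *s v i)"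
    have y: "cdot y z = (\<Sum>i\<in>I. cnj (cdot (v i) (P *v x)) * cdot (v i) z)" for z
    proof -
      have "cdot y z = cnj (cdot z y)" by (simp add: cnj_cdot)
      then show ?thesis
        by (simp add: y_def cdot_sum_right cdot_simps cnj_cdot)
    qed
    have "x - y \<in> V"
    proof -
      have "cdot (v i) (P *v y) = cdot (v i) (P *v x)" if "i \<in> I" for i
      proof -
        have "cdot (v i) (P *v y) = cnj (cdot y (P *v v i))"
          by (rule cdot_hermitian [OF hP])
        also have "\<dots> = (\<Sum>k\<in>I. cdot (v k) (P *v x) * (if k = i then 1 else 0))"
          by (auto simp: y orth that intro!: sum.cong)
        finally show ?thesis using that by (simp add: if_distrib cong: if_cong)
      qed
      then show ?thesis
        by (simp add: V_def matrix_vector_mult_diff_distrib cdot_simps)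
    qed
    then have "cdot (x - y) (B *v u) = 0" by (rule perpV)
    moreover have "cdot y (B *v u) = 0"
      by (simp add: y perp_v)
    ultimately show "cdot x (B *v u) = 0"
      by (simp add: cdot_simps)
  qed
  then have Ku: "K *v u = of_real \<mu> *s (P *v u)"
    by (simp add: B)
  define r where "r = Re (qform P u)"
  have r: "r > 0" "cdot u (P *v u) = of_real r"
    using pos [OF \<open>u \<noteq> 0\<close>] cdot_hermitian_real [OF hP, of u] by (simp_all add: r_def qform_eq_cdot)
  define w where "w = of_real (1 / sqrt r) *s u"
  show thesis
  proof
    show "K *v w = of_real \<mu> *s (P *v w)"
      by (simp add: w_def vector_scalar_commute Ku vector_smult_assoc mult.commute)
    have "cdot w (P *v w) = of_real (1 / sqrt r * (1 / sqrt r * r))"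
      by (simp only: w_def vector_scalar_commute cdot_simps r(2) complex_cnj_complex_of_real of_real_mult)
    moreover have "1 / sqrt r * (1 / sqrt r * r) = 1" using r(1) by simp
    ultimately show "cdot w (P *v w) = 1" by simp
    show "cdot (v i) (P *v w) = 0" if "i \<in> I" for i
      using \<open>u \<in> V\<close> that by (simp add: w_def V_def vector_scalar_commute cdot_simps)
  qed
qed

lemma simultaneous_diagonalization:
  fixes P K :: "complex ^ 'n ^ 'n"
  assumes hP: "ctranspose P = P" and hK: "ctranspose K = K"
    and pos: "\<And>x. x \<noteq> 0 \<Longrightarrow> Re (qform P x) > 0"
  obtains v :: "'n \<Rightarrow> complex ^ 'n" and l :: "'n \<Rightarrow> real"
  where "\<And>i. K *v v i = of_real (l i) *s (P *v v i)"
    "\<And>i k. cdot (v i) (P *v v k) = (if i = k then 1 else 0)"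
proof -
  have "\<exists>(v :: 'n \<Rightarrow> complex ^ 'n) (l :: 'n \<Rightarrow> real).
      (\<forall>i\<in>I. K *v v i = of_real (l i) *s (P *v v i)) \<and>
      (\<forall>i\<in>I. \<forall>k\<in>I. cdot (v i) (P *v v k) = (if i = k then 1 else 0))" if "finite I" for I
    using that
  proof (induction I)
    case (insert j I)
    then obtain v :: "'n \<Rightarrow> complex ^ 'n" and l :: "'n \<Rightarrow> real"
      where eig: "\<And>i. i \<in> I \<Longrightarrow> K *v v i = of_real (l i) *s (P *v v i)"
        and orth: "\<And>i k. i \<in> I \<Longrightarrow> k \<in> I \<Longrightarrow> cdot (v i) (P *v v k) = (if i = k then 1 else 0)"
      by blast
    obtain w \<mu> where w: "K *v w = of_real \<mu> *s (P *v w)" "cdot w (P *v w) = 1"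
      "\<And>i. i \<in> I \<Longrightarrow> cdot (v i) (P *v w) = 0"
      using simultaneous_diagonalization_step [OF hP hK pos insert.hyps(2) eig orth] by blast
    have w': "cdot w (P *v v i) = 0" if "i \<in> I" for i
      using w(3) [OF that] by (subst cdot_hermitian [OF hP]) simp
    show ?case
      by (rule exI [of _ "v(j := w)"], rule exI [of _ "l(j := \<mu>)"])
        (use eig orth w w' insert.hyps(2) in auto)
  qed simp
  from this [of UNIV] that show thesis by auto
qed

section \<open>Phases of sectorial matrices\<close>

lemma congruence_entry:
  "(ctranspose V ** A ** V) $ i $ k = cdot (column i V) (A *v column k V)"
  unfolding matrix_mul_assoc [symmetric]
  by (simp add: matrix_matrix_mult_def ctranspose_def cdot_def matrix_vector_mult_def column_def)

lemma diag_unitary_mult_vector: "(diag_unitary \<theta> *v x) $ i = cis (\<theta> i) * x $ i"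
  by (simp add: diag_unitary_def matrix_vector_mult_def if_distrib [of "\<lambda>c. c * _"] cong: if_cong)

lemma diag_unitary_minus: "diag_unitary (\<lambda>i. - \<theta> i) ** diag_unitary \<theta> = mat 1"
  unfolding matrix_eq
  by (simp add: vec_eq_iff diag_unitary_mult_vector cis_mult flip: matrix_vector_mul_assoc mult.assoc)

text \<open>Rotated by \<open>- \<alpha>\<close>, \<open>A\<close> is \<open>P + \<i> K\<close> with
  both parts hermitian and \<open>P\<close> positive definite. Diagonalizing both gives entries
  \<open>cis \<alpha> * (1 + \<i> * l i)\<close>, with arguments
  \<open>\<alpha> + arctan (l i)\<close>; their moduli are scaled away.\<close>

lemma congruence_diag_unitary_exists:
  fixes A :: "complex ^ 'n ^ 'n"
  assumes "sectorial A"
  obtains T and \<theta> :: "'n \<Rightarrow> real" and \<alpha> where "invertible T" "A = ctranspose T ** diag_unitary \<theta> ** T"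
    "\<And>i. \<bar>\<theta> i - \<alpha>\<bar> < pi / 2"
proof -
  obtain \<alpha> where \<alpha>: "\<And>x. x \<noteq> 0 \<Longrightarrow> Re (cis (- \<alpha>) * qform A x) > 0"
    using sectorial_rotation [OF assms] by blast
  define P :: "complex ^ 'n ^ 'n" where
    "P = (\<chi> i k. (cis (- \<alpha>) * A $ i $ k + cnj (cis (- \<alpha>) * A $ k $ i)) / 2)"
  define K :: "complex ^ 'n ^ 'n" where
    "K = (\<chi> i k. (cis (- \<alpha>) * A $ i $ k - cnj (cis (- \<alpha>) * A $ k $ i)) / (2 * \<i>))"
  have hP: "ctranspose P = P" and hK: "ctranspose K = K"
    by (simp_all add: P_def K_def ctranspose_def vec_eq_iff add.commute field_simps)
  have ent: "A $ i $ k = cis \<alpha> * (P $ i $ k + \<i> * K $ i $ k)" for i k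
  proof -
    have "P $ i $ k + \<i> * K $ i $ k = cis (- \<alpha>) * A $ i $ k"
      by (simp add: P_def K_def field_simps)
    then show ?thesis by (simp add: cis_mult flip: mult.assoc)
  qed
  have A: "A *v x = cis \<alpha> *s (P *v x + \<i> *s (K *v x))" for x
    by (simp add: vec_eq_iff matrix_vector_mult_def ent sum_distrib_left algebra_simps flip: sum.distrib)
  have "Re (qform P x) > 0" if "x \<noteq> 0" for x
  proof -
    have "cis (- \<alpha>) * qform A x = cis (- \<alpha>) * cis \<alpha> * (cdot x (P *v x) + \<i> * cdot x (K *v x))"
      by (simp add: qform_eq_cdot A cdot_simps algebra_simps)
    also have "\<dots> = cdot x (P *v x) + \<i> * cdot x (K *v x)"
      by (simp add: cis_mult)
    also have "Re \<dots> = Re (cdot x (P *v x))"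
      by (subst cdot_hermitian_real [OF hK]) simp
    finally show ?thesis using \<alpha> [OF that] by (simp add: qform_eq_cdot)
  qed
  then obtain v :: "'n \<Rightarrow> complex ^ 'n" and l :: "'n \<Rightarrow> real"
    where v: "\<And>i. K *v v i = of_real (l i) *s (P *v v i)"
      "\<And>i k. cdot (v i) (P *v v k) = (if i = k then 1 else 0)"
    using simultaneous_diagonalization [OF hP hK] by metis
  define r where "r i = sqrt (1 + (l i)\<^sup>2)" for i
  have r: "r i > 0" for i by (simp add: r_def add_pos_nonneg)
  define \<theta> where "\<theta> i = \<alpha> + arctan (l i)" for i
  have rl: "1 + \<i> * of_real (l i) = of_real (r i) * cis (arctan (l i))" for i
    using r [of i] by (simp add: complex_eq_iff cos_arctan sin_arctan flip: r_def)
  \<comment> \<open>Dividing column \<open>k\<close> by \<open>sqrt (r k)\<close> removes the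
    modulus \<open>r k\<close> from the diagonal entry, since the column enters twice.\<close>
  define U where "U = (\<chi> i k. (of_real (1 / sqrt (r k)) *s v k) $ i)"
  have colU: "column k U = of_real (1 / sqrt (r k)) *s v k" for k
    by (simp add: U_def column_def vec_eq_iff)
  have normalize: "of_real (1 / sqrt (r k)) * (of_real (1 / sqrt (r k)) * (complex_of_real (r k) * z)) = z"
    for k z
  proof -
    have "1 / sqrt (r k) * (1 / sqrt (r k)) * r k = 1" using r [of k] by simp
    then show ?thesis
      by (simp only: of_real_mult [symmetric] mult.assoc [symmetric]) simp
  qed
  have "ctranspose U ** A ** U = diag_unitary \<theta>"
    unfolding vec_eq_iff
  proof (intro allI)
    fix i k
    have e1: "cdot (v i) (A *v v k) = (if i = k then of_real (r i) * cis (\<theta> i) else 0)"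
      by (simp add: A v cdot_simps \<theta>_def cis_mult [symmetric] mult.left_commute [of _ "cis \<alpha>"]
          distrib_left flip: rl)
    have e2: "(ctranspose U ** A ** U) $ i $ k =
        of_real (1 / sqrt (r i)) * (of_real (1 / sqrt (r k)) * cdot (v i) (A *v v k))"
      by (simp only: congruence_entry colU vector_scalar_commute cdot_simps complex_cnj_complex_of_real)
        simp
    show "(ctranspose U ** A ** U) $ i $ k = diag_unitary \<theta> $ i $ k"
    proof (cases "i = k")
      case True
      show ?thesis
        unfolding e2 e1 by (simp only: True if_True simp_thms normalize diag_unitary_def vec_lambda_beta)
    qed (simp add: e2 e1 diag_unitary_def)
  qed
  \<comment> \<open>An explicit left inverse of \<open>U\<close>, which yields
    invertibility.\<close>
  then have "diag_unitary (\<lambda>i. - \<theta> i) ** ctranspose U ** A ** U = mat 1"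
    by (metis diag_unitary_minus matrix_mul_assoc)
  then have "invertible U" by (metis invertible_left_inverse)
  then obtain T where T: "U ** T = mat 1" "T ** U = mat 1"
    by (auto simp: invertible_def)
  have T': "ctranspose T ** ctranspose U = mat 1"
    by (metis T(1) ctranspose_mat_1 ctranspose_mult)
  have "ctranspose T ** diag_unitary \<theta> ** T = ctranspose T ** (ctranspose U ** A ** U) ** T"
    by (simp add: \<open>ctranspose U ** A ** U = diag_unitary \<theta>\<close>)
  also have "\<dots> = (ctranspose T ** ctranspose U) ** A ** (U ** T)"
    by (simp add: matrix_mul_assoc)
  also have "\<dots> = A" by (simp add: T T')
  finally have "A = ctranspose T ** diag_unitary \<theta> ** T" ..
  moreover have "invertible T" using T invertible_def by blast
  moreover have "\<bar>\<theta> i - \<alpha>\<bar> < pi / 2" for i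
    using arctan_bounded [of "l i"] unfolding \<theta>_def by linarith
  ultimately show thesis by (intro that [of T \<theta> \<alpha>])
qed

text \<open>Justifies the choice in \<open>phases\<close>: the arguments just constructed lie in an
  open interval of length \<open>pi\<close>, and a common shift by a multiple of
  \<open>2 * pi\<close> places their midpoint.\<close>

lemma is_phases_phases:
  fixes A :: "complex ^ 'n ^ 'n"
  assumes "sectorial A"
  shows "is_phases A (phases A)"
proof -
  obtain T and \<theta> :: "'n \<Rightarrow> real" and \<alpha> where T: "invertible T" "A = ctranspose T ** diag_unitary \<theta> ** T"
    and \<theta>: "\<And>i. \<bar>\<theta> i - \<alpha>\<bar> < pi / 2"
    using congruence_diag_unitary_exists [OF assms] by metis
  have "Max (range \<theta>) \<in> range \<theta>" "Min (range \<theta>) \<in> range \<theta>"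
    by (intro Max_in Min_in; simp)+
  then obtain i k where "Max (range \<theta>) = \<theta> i" "Min (range \<theta>) = \<theta> k" by blast
  then have spread: "Max (range \<theta>) - Min (range \<theta>) < pi"
    using \<theta> [of i] \<theta> [of k] unfolding abs_less_iff by argo
  define m where "m = (Max (range \<theta>) + Min (range \<theta>)) / 2"
  \<comment> \<open>The least integer with \<open>m - 2 * pi * n \<le> pi\<close>; the ceiling
    matches the interval being closed on the right.\<close>
  define n where "n = \<lceil>(m - pi) / (2 * pi)\<rceil>"
  define c where "c = - (2 * pi * of_int n)"
  have "(m - pi) / (2 * pi) \<le> of_int n" "of_int n < (m - pi) / (2 * pi) + 1"
    unfolding n_def by linarith+
  then have "m - pi \<le> 2 * pi * of_int n" "2 * pi * of_int n < m + pi"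
    by (simp_all add: field_simps)
  then have mid: "m + c \<in> {- pi<..pi}"
    by (auto simp: c_def)
  have shift: "Max (range (\<lambda>i. \<theta> i + c)) = Max (range \<theta>) + c" "Min (range (\<lambda>i. \<theta> i + c)) = Min (range \<theta>) + c"
    by (simp_all add: Max_add_commute Min_add_commute)
  have "cis c = 1"
    unfolding c_def by (metis cis_cnj cis_multiple_2pi complex_cnj_one Ints_of_int)
  then have "diag_unitary (\<lambda>i. \<theta> i + c) = diag_unitary \<theta>"
    by (simp add: diag_unitary_def vec_eq_iff cis_mult [symmetric])
  with T spread mid have "is_phases A (\<lambda>i. \<theta> i + c)"
    unfolding is_phases_def shift m_def by (auto simp: field_simps)
  then show ?thesis
    unfolding phases_def by (rule someI [of "is_phases A"])
qed

text \<open>A sector of opening below \<open>pi\<close> is a convex cone. Rotated by its mid-angle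
  \<open>m\<close>, it is given by \<open>\<bar>Im z\<bar> \<le> tan h * Re z\<close>, an inequality
  preserved by nonnegative combinations; \<open>r k > 0\<close> keeps the sum away from 0.\<close>

lemma sum_cis_in_cone:
  fixes r \<theta> :: "'n::finite \<Rightarrow> real"
  assumes r: "\<And>i. r i \<ge> 0" "r k > 0"
    and \<theta>: "\<And>i. a \<le> \<theta> i" "\<And>i. \<theta> i \<le> b" and ab: "b - a < pi"
  obtains \<rho> \<phi> where "\<rho> > 0" "a \<le> \<phi>" "\<phi> \<le> b" "(\<Sum>i\<in>UNIV. of_real (r i) * cis (\<theta> i)) = of_real \<rho> * cis \<phi>"
proof -
  define m where "m = (a + b) / 2"
  define h where "h = (b - a) / 2"
  have h: "h < pi / 2" "0 \<le> h" using ab \<theta>(1) [of k] \<theta>(2) [of k] by (simp_all add: h_def)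
  have th: "\<bar>\<theta> i - m\<bar> \<le> h" for i
    using \<theta>(1) [of i] \<theta>(2) [of i] unfolding m_def h_def abs_le_iff by argo
  define q where "q = (\<Sum>i\<in>UNIV. of_real (r i) * cis (\<theta> i - m))"
  have Re: "Re q = (\<Sum>i\<in>UNIV. r i * cos (\<theta> i - m))" and Im: "Im q = (\<Sum>i\<in>UNIV. r i * sin (\<theta> i - m))"
    by (simp_all add: q_def)
  have cos: "cos (\<theta> i - m) > 0" for i
    using th [of i] h by (intro cos_gt_zero_pi) auto
  have Re_pos: "Re q > 0"
    unfolding Re using r cos by (intro sum_pos2 [of _ k]) (simp_all add: less_imp_le)
  have sin_le: "\<bar>sin (\<theta> i - m)\<bar> \<le> tan h * cos (\<theta> i - m)" for i
  proof -
    have "tan \<bar>\<theta> i - m\<bar> \<le> tan h"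
      using th [of i] h by (subst tan_mono_le_eq) auto
    moreover have "tan \<bar>x\<bar> = \<bar>sin x\<bar> / cos x" if "\<bar>x\<bar> < pi / 2" for x :: real
    proof (cases "x \<ge> 0")
      case True
      then have "sin x \<ge> 0" using that by (intro sin_ge_zero) auto
      with True show ?thesis by (simp add: tan_def)
    next
      case False
      then have "sin (- x) \<ge> 0" using that by (intro sin_ge_zero) auto
      with False show ?thesis by (simp add: tan_def)
    qed
    then have "tan \<bar>\<theta> i - m\<bar> = \<bar>sin (\<theta> i - m)\<bar> / cos (\<theta> i - m)"
      using th [of i] h by fastforce
    ultimately show ?thesis using cos [of i] by (simp add: divide_le_eq)
  qed
  have "\<bar>Im q\<bar> \<le> (\<Sum>i\<in>UNIV. \<bar>r i * sin (\<theta> i - m)\<bar>)"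
    unfolding Im by (rule sum_abs)
  also have "\<dots> \<le> (\<Sum>i\<in>UNIV. r i * (tan h * cos (\<theta> i - m)))"
    using r(1) sin_le by (intro sum_mono) (simp add: abs_mult mult_left_mono)
  also have "\<dots> = tan h * Re q"
    by (simp add: Re sum_distrib_left mult_ac)
  finally have "\<bar>Im q / Re q\<bar> \<le> tan h"
    using Re_pos by (simp add: divide_le_eq)
  then have "arctan \<bar>Im q / Re q\<bar> \<le> arctan (tan h)"
    by (simp only: arctan_le_iff)
  then have "\<bar>arctan (Im q / Re q)\<bar> \<le> h"
    using h by (simp add: arctan_tan abs_if arctan_minus split: if_splits)
  then have "\<bar>Arg q\<bar> \<le> h" using Re_pos by (simp add: arg_conv_arctan)
  then have "a \<le> m + Arg q" "m + Arg q \<le> b"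
    unfolding m_def h_def abs_le_iff by argo+
  moreover have "(\<Sum>i\<in>UNIV. of_real (r i) * cis (\<theta> i)) = cis m * q"
    by (simp add: q_def sum_distrib_left mult.left_commute [of "cis m"] cis_mult)
  then have "(\<Sum>i\<in>UNIV. of_real (r i) * cis (\<theta> i)) = of_real (cmod q) * cis (m + Arg q)"
    by (metis cis_mult mult.left_commute rcis_cmod_Arg rcis_def)
  moreover have "cmod q > 0" using Re_pos by auto
  ultimately show thesis using that by blast
qed

text \<open>In the decomposition through \<open>T\<close>, the form at \<open>x\<close> is the sum
  of the unimodular diagonal entries weighted by the squared moduli of the coordinates of
  \<open>T *v x\<close>, which is nonzero.\<close>

lemma qform_phase:
  fixes A :: "complex ^ 'n ^ 'n"
  assumes "sectorial A" "x \<noteq> 0"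
  obtains \<rho> \<phi> where "\<rho> > 0" "min_phase A \<le> \<phi>" "\<phi> \<le> max_phase A" "qform A x = of_real \<rho> * cis \<phi>"
proof -
  let ?\<theta> = "phases A"
  obtain T where T: "invertible T" "A = ctranspose T ** diag_unitary ?\<theta> ** T"
    and spread: "max_phase A - min_phase A < pi"
    using is_phases_phases [OF assms(1)] by (auto simp: is_phases_def max_phase_def min_phase_def)
  have "T *v x \<noteq> 0"
    using T(1) assms(2) by (metis invertible_left_inverse matrix_left_invertible_ker)
  then obtain k where k: "(T *v x) $ k \<noteq> 0" by (auto simp: vec_eq_iff)
  have "qform A x = cdot x (ctranspose T *v (diag_unitary ?\<theta> *v (T *v x)))"
    unfolding qform_eq_cdot by (subst T(2)) (simp add: matrix_vector_mul_assoc matrix_mul_assoc)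
  also have "\<dots> = cdot (T *v x) (diag_unitary ?\<theta> *v (T *v x))"
    by (metis cdot_ctranspose ctranspose_ctranspose)
  also have "\<dots> = (\<Sum>i\<in>UNIV. of_real ((cmod ((T *v x) $ i))\<^sup>2) * cis (?\<theta> i))"
    by (simp add: cdot_def diag_unitary_mult_vector cmod_square mult_ac)
  finally have eq: "qform A x = \<dots>" .
  have "min_phase A \<le> ?\<theta> i" "?\<theta> i \<le> max_phase A" for i
    by (simp_all add: min_phase_def max_phase_def)
  then show thesis
    using sum_cis_in_cone [of "\<lambda>i. (cmod ((T *v x) $ i))\<^sup>2" k "min_phase A" ?\<theta> "max_phase A"]
      spread k that unfolding eq by auto
qed

section \<open>The pointwise separation conditions\<close>

lemma no_null_vector_small_gain:
  fixes A B :: "complex ^ 'n ^ 'n"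
  assumes "max_sv A * max_sv B < 1" and y: "y = - of_real t *s (B *v (A *v y))" "y \<noteq> 0"
    and t: "t \<in> {0<..1::real}"
  shows False
proof -
  \<comment> \<open>The norm bound at a unit vector shows that \<open>max_sv B\<close> is
    nonnegative.\<close>
  have "0 \<le> max_sv B * norm (axis undefined 1 :: complex ^ 'n)"
    by (rule order_trans [OF norm_ge_zero norm_le_max_sv])
  then have B0: "max_sv B \<ge> 0" by simp
  have "norm y = t * norm (B *v (A *v y))"
    using t by (subst y(1)) (simp only: norm_vector_scalar, simp)
  also have "\<dots> \<le> norm (B *v (A *v y))"
    using t by (simp add: mult_left_le_one_le)
  also have "\<dots> \<le> max_sv B * norm (A *v y)"
    by (rule norm_le_max_sv)
  also have "\<dots> \<le> max_sv B * (max_sv A * norm y)"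
    by (intro mult_left_mono norm_le_max_sv B0)
  also have "\<dots> = max_sv A * max_sv B * norm y" by simp
  also have "\<dots> < 1 * norm y"
    using assms(1) y(2) by (intro mult_strict_right_mono) auto
  finally show False by simp
qed

text \<open>With \<open>x = A *v y\<close>, the number \<open>cdot x y\<close> is both the conjugate
  of \<open>qform A y\<close> and \<open>- t * qform B x\<close>. So
  \<open>cis (\<psi> + \<phi>)\<close> would be a negative real number, although
  \<open>\<psi> + \<phi>\<close> lies strictly between \<open>- pi\<close> and
  \<open>pi\<close>.\<close>

lemma no_null_vector_small_phase:
  fixes A B :: "complex ^ 'n ^ 'n"
  assumes sec: "sectorial A" "sectorial B"
    and ph: "max_phase A + max_phase B < pi" "min_phase A + min_phase B > - pi"
    and y: "y = - of_real t *s (B *v (A *v y))" "y \<noteq> 0" and t: "t > 0"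
  shows False
proof -
  define x where "x = A *v y"
  have x: "x \<noteq> 0" using y by (auto simp: x_def)
  obtain \<rho> \<phi> where \<rho>: "\<rho> > 0" "min_phase A \<le> \<phi>" "\<phi> \<le> max_phase A" "qform A y = of_real \<rho> * cis \<phi>"
    using qform_phase [OF sec(1) y(2)] by blast
  obtain \<sigma> \<psi> where \<sigma>: "\<sigma> > 0" "min_phase B \<le> \<psi>" "\<psi> \<le> max_phase B" "qform B x = of_real \<sigma> * cis \<psi>"
    using qform_phase [OF sec(2) x] by blast
  have "cdot x y = - of_real t * qform B x"
    by (subst y(1)) (simp add: cdot_simps qform_eq_cdot x_def)
  moreover have "cdot x y = cnj (qform A y)"
    by (simp add: qform_eq_cdot cnj_cdot x_def)
  ultimately have "of_real \<rho> * cis (- \<phi>) = - of_real (t * \<sigma>) * cis \<psi>"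
    by (simp add: \<rho>(4) \<sigma>(4) cis_cnj)
  then have "of_real \<rho> * cis (- \<phi>) * cis \<phi> = - of_real (t * \<sigma>) * cis \<psi> * cis \<phi>"
    by simp
  then have eq: "of_real \<rho> = - of_real (t * \<sigma>) * cis (\<psi> + \<phi>)"
    by (simp add: cis_mult mult.assoc)
  have "t * \<sigma> * sin (\<psi> + \<phi>) = 0"
    using arg_cong [OF eq, of Im] by simp
  then have "sin (\<psi> + \<phi>) = 0" using t \<sigma>(1) by simp
  moreover have "- pi < \<psi> + \<phi>" "\<psi> + \<phi> < pi"
    using ph \<rho>(2,3) \<sigma>(2,3) by linarith+
  ultimately have "\<psi> + \<phi> = 0"
    by (rule sin_eq_0_pi [rotated 2])
  then have "\<rho> = - (t * \<sigma>)"
    using arg_cong [OF eq, of Re] by simp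
  then show False using \<rho>(1) \<sigma>(1) t mult_pos_pos [of t \<sigma>] by linarith
qed

text \<open>Two matrices that agree at a unit vector have a common point in their numerical ranges,
  \<open>x\<close>-\<open>z\<close> graphs and shells alike.\<close>

lemma shells_intersect:
  fixes A B :: "complex ^ 'n ^ 'n"
  assumes "invertible B" and y: "y = - of_real t *s (B *v (A *v y))" "y \<noteq> 0" and t: "t > 0"
  obtains z where "norm z = 1" "A *v z = ((- 1 / t) *\<^sub>R matrix_inv B) *v z"
proof -
  have B: "matrix_inv B ** B = mat 1"
    using assms(1) unfolding invertible_def matrix_inv_def by (metis (mono_tags, lifting) someI_ex)
  have "matrix_inv B *v y = matrix_inv B *v (- of_real t *s (B *v (A *v y)))"
    using y(1) by simp
  also have "\<dots> = - of_real t *s (A *v y)"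
    unfolding vector_scalar_commute matrix_vector_mul_assoc [of "matrix_inv B"] B by simp
  finally have inv: "matrix_inv B *v y = - of_real t *s (A *v y)" .
  have "complex_of_real (- 1 / t) * - of_real t = 1" using t by simp
  then have Ay: "A *v y = ((- 1 / t) *\<^sub>R matrix_inv B) *v y"
    by (simp only: scaleR_matrix_vector inv vector_smult_assoc vector_smult_lid)
  show thesis
    by (rule that [OF norm_normalized [OF y(2)]]) (simp only: vector_scalar_commute Ay)
qed

lemma det_return_difference_nonzero:
  fixes A B :: "complex ^ 'n ^ 'n"
  assumes cond: "max_sv A * max_sv B < 1
    \<or> (sectorial A \<and> sectorial B \<and> max_phase A + max_phase B < pi \<and> min_phase A + min_phase B > - pi)
    \<or> (invertible B \<and> (\<forall>\<tau>\<in>{0<..1::real}. num_range A \<inter> num_range ((- 1 / \<tau>) *\<^sub>R matrix_inv B) = {}))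
    \<or> (invertible B \<and> (\<forall>\<tau>\<in>{0<..1::real}. xz_graph A \<inter> xz_graph ((- 1 / \<tau>) *\<^sub>R matrix_inv B) = {}))
    \<or> (invertible B \<and> (\<forall>\<tau>\<in>{0<..1::real}. DW_shell A \<inter> DW_shell ((- 1 / \<tau>) *\<^sub>R matrix_inv B) = {}))
    \<or> (\<forall>\<tau>\<in>{0<..1::real}. det (mat 1 + \<tau> *\<^sub>R (A ** B)) \<noteq> 0)"
    and t: "t \<in> {0<..1::real}"
  shows "det (mat 1 + t *\<^sub>R (B ** A)) \<noteq> 0"
proof
  assume "det (mat 1 + t *\<^sub>R (B ** A)) = 0"
  then obtain y where "y \<noteq> 0" and null: "(mat 1 + t *\<^sub>R (B ** A)) *v y = 0"
    using exists_null_vector by blast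
  have "y + of_real t *s (B *v (A *v y)) = 0"
    using null by (simp add: matrix_vector_mult_add_rdistrib scaleR_matrix_vector matrix_vector_mul_assoc)
  then have y: "y = - of_real t *s (B *v (A *v y))" "y \<noteq> 0"
    using \<open>y \<noteq> 0\<close> by (simp_all add: eq_neg_iff_add_eq_0 vector_smult_lneg)
  have sep: "num_range A \<inter> num_range ((- 1 / t) *\<^sub>R matrix_inv B) \<noteq> {}"
    "xz_graph A \<inter> xz_graph ((- 1 / t) *\<^sub>R matrix_inv B) \<noteq> {}"
    "DW_shell A \<inter> DW_shell ((- 1 / t) *\<^sub>R matrix_inv B) \<noteq> {}" if inv: "invertible B"
  proof -
    have "t > 0" using t by simp
    then obtain z where z: "norm z = 1" "A *v z = ((- 1 / t) *\<^sub>R matrix_inv B) *v z"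
      using shells_intersect [OF inv y] by blast
    then have "qform A z = qform ((- 1 / t) *\<^sub>R matrix_inv B) z"
      by (simp add: qform_eq_cdot)
    with z show "num_range A \<inter> num_range ((- 1 / t) *\<^sub>R matrix_inv B) \<noteq> {}"
      "xz_graph A \<inter> xz_graph ((- 1 / t) *\<^sub>R matrix_inv B) \<noteq> {}"
      "DW_shell A \<inter> DW_shell ((- 1 / t) *\<^sub>R matrix_inv B) \<noteq> {}"
      unfolding num_range_def xz_graph_def DW_shell_def by (simp_all add: disjoint_iff) metis+
  qed
  \<comment> \<open>Exchanges the order of the factors for the determinant condition:
    \<open>A *v y\<close> is a null vector for \<open>A ** B\<close>, and it is nonzero since
    otherwise \<open>y = 0\<close>.\<close>
  have "det (mat 1 + t *\<^sub>R (A ** B)) = 0"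
  proof (rule ccontr)
    assume "det (mat 1 + t *\<^sub>R (A ** B)) \<noteq> 0"
    then obtain C where "C ** (mat 1 + t *\<^sub>R (A ** B)) = mat 1"
      by (auto simp flip: invertible_det_nz simp: invertible_left_inverse)
    moreover have "(mat 1 + t *\<^sub>R (A ** B)) *v (A *v y) = A *v (y + of_real t *s (B *v (A *v y)))"
      by (simp add: matrix_vector_mult_add_rdistrib scaleR_matrix_vector matrix_vector_right_distrib
          vector_scalar_commute flip: matrix_vector_mul_assoc)
    then have "(mat 1 + t *\<^sub>R (A ** B)) *v (A *v y) = 0"
      by (simp add: \<open>y + of_real t *s (B *v (A *v y)) = 0\<close>)
    ultimately have "A *v y = 0"
      by (metis matrix_left_invertible_ker)
    then show False using y by simp
  qed
  moreover have "\<not> max_sv A * max_sv B < 1"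
    using no_null_vector_small_gain [OF _ y t] by blast
  moreover have "\<not> (sectorial A \<and> sectorial B \<and> max_phase A + max_phase B < pi \<and> min_phase A + min_phase B > - pi)"
    using no_null_vector_small_phase [OF _ _ _ _ y] t by auto
  ultimately show False
    using cond sep t by blast
qed

theorem theorem4p6:
  fixes G H :: "('m::finite) tf_matrix"
  assumes "G \<in> RH_inf" and "H \<in> RH_inf" and "invertible H"
    and "\<forall>\<omega>\<in>{0..\<infinity>::ereal}.
      max_sv (freq_resp G \<omega>) * max_sv (freq_resp H \<omega>) < 1
    \<or> (sectorial (freq_resp G \<omega>) \<and> sectorial (freq_resp H \<omega>) \<and>
       max_phase (freq_resp G \<omega>) + max_phase (freq_resp H \<omega>) < pi \<and>
       min_phase (freq_resp G \<omega>) + min_phase (freq_resp H \<omega>) > - pi)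
    \<or> (invertible (freq_resp H \<omega>) \<and> (\<forall>\<tau>\<in>{0<..1::real}.
       num_range (freq_resp G \<omega>) \<inter>
       num_range ((- 1 / \<tau>) *\<^sub>R matrix_inv (freq_resp H \<omega>)) = {}))
    \<or> (invertible (freq_resp H \<omega>) \<and> (\<forall>\<tau>\<in>{0<..1::real}.
       xz_graph (freq_resp G \<omega>) \<inter>
       xz_graph ((- 1 / \<tau>) *\<^sub>R matrix_inv (freq_resp H \<omega>)) = {}))
    \<or> (invertible (freq_resp H \<omega>) \<and> (\<forall>\<tau>\<in>{0<..1::real}.
       DW_shell (freq_resp G \<omega>) \<inter>
       DW_shell ((- 1 / \<tau>) *\<^sub>R matrix_inv (freq_resp H \<omega>)) = {}))
    \<or> (\<forall>\<tau>\<in>{0<..1::real}.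
       det (mat 1 + \<tau> *\<^sub>R (freq_resp G \<omega> ** freq_resp H \<omega>)) \<noteq> 0)"
  shows "closed_loop_stable G H"
  using assms(4)
  by (intro closed_loop_stable_if_det_nonzero [OF assms(1,2)] det_return_difference_nonzero) blast+

end
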